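(* Let $\hat C,\tilde C>0$ be chosen such that $$(1-\beta/p(k))\,\hat C^{1/(1-\beta/p(k))}+(1-\gamma/p(k))\,\tilde C^{1/(1-\gamma/p(k))}\le\frac{2}{C_L\overline{C}_0},$$ and let the stabilization coefficient be $$A=C_L\left(\frac{\beta}{2p(k)}\hat C^{-p(k)/\beta}+\frac{\gamma}{2p(k)}\tilde C^{-p(k)/\gamma}\right)\overline{C}_0 $$ (if one of $\beta,\gamma$ is zero, the corresponding expressions are read as limits, as explained in the context). Then the variable-step numerical scheme $$\frac{du^{n+1}(t)}{dt}+\epsilon\mathcal L u^{n+1}(t)+A\tau^k\frac{d}{dt}\mathcal L^{p(k)}u^{n+1}(t)=\sum_{i=0}^{k-1}\ell_i(t-t_n)F(u^{n-i}),\qquad t\in[t_n,t_{n+1}],$$ with $u^{n+1}(t)=u^n(t)$ for $t\in[0,t_n]$, is energy stable in the sense that $$\tilde E(u^{n+1})\le\tilde E(u^n)\qquad\text{for all }n\ge k,$$ where the modified energy is $$\tilde E(u^n)=E(u^n)+C_LC_3\sum_{j=1}^{k-1}\overline{C}_j\left\|\frac{du^{n-j+1}(t)}{dt}\right\|_{L^2(I_{n-j}^1;\mathcal H)}^2+C_LC_4\sum_{j=1}^{k-1}\overline{C}_j\,\tau^k\left\|\frac{du^{n-j+1}(t)}{dt}\right\|_{L^2(I_{n-j}^1;V^{p(k)})}^2,$$ with $$C_3=\tfrac{1-\gamma/p(k)}{2}\,\tilde C^{1/(1-\gamma/p(k))},\qquad C_4=\tfrac{\gamma}{2p(k)}\,\tilde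 C^{-p(k)/\gamma}.$$
   Context: Setting. $X\hookrightarrow\mathcal H\hookrightarrow X'$ is a standard triple of Hilbert spaces and $\mathcal L$ is a positive definite linear operator on $\mathcal H$ mapping $X$ to its dual $X'$, self-adjoint and nonnegative on $\mathcal H$. For $\alpha\ge0$, $V^\alpha$ is the domain of $\mathcal L^{\alpha/2}$ with norm $\|v\|_{V^\alpha}=\|\mathcal L^{\alpha/2}v\|_{\mathcal H}$ (so $V^0=\mathcal H$), and $V^{-\alpha}$ is the dual of $V^\alpha$ induced by the inner product of $\mathcal H$. $\epsilon>0$ is a constant. The energy is $E(u)=\frac{\epsilon}{2}\|\mathcal L^{1/2}u\|_{\mathcal H}^2+\mathcal F(u)$, and $F=-\frac{\delta\mathcal F}{\delta u}$ (negative variational derivative of $\mathcal F$ with respect to the inner product of $\mathcal H$). The gradient flow is $\frac{\partial u}{\partial t}+\epsilon\mathcal Lu=F(u)$. Lipschitz assumption: there are exponents $\beta\ge0$, $\gamma\ge0$ and a constant $C_L>0$ with $$\|F(u)-F(v)\|_{V^{-\beta}}\le C_L\|u-v\|_{V^\gamma}\quad\text{for all }u,v\in V^\gamma.$$ Choice of $p(k)$: $p(k)=\frac{(\beta+\gamma)k}{2}$, and it is assumed that $p(k)>\max\{\beta,\gamma\}$ (so at least one of $\beta,\gamma$ is positive). Case of one zero exponent. If $\beta=0<\gamma$, the expressions containing $\beta$ are read as limits $\beta\to0^+$: the first term of the condition on $\hat C,\tilde C$ is $\hat C$, and $\frac{\beta}{2p(k)}\hat C^{-p(k)/\beta}$ is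 $0$ for $\hat C\ge1$ and $+\infty$ (not admissible) for $\hat C<1$; thus $\hat C\ge1$. If $\gamma=0<\beta$, the same reading applies with $\tilde C$ in place of $\hat C$; thus $\tilde C\ge1$, $C_3=\tilde C/2$ and $C_4=0$. The value $1$ for the constant attached to the zero exponent is the basic case. Time grid and scheme. $k\ge1$ is an integer; $0=t_0<t_1<\cdots$ are time nodes, $\tau_n=t_{n+1}-t_n$, $\tau=\max_j\tau_j$ over all steps. The ratio between the maximum and minimum time-step in any $k$ neighboring steps is bounded by a constant independent of the step sizes. $u^m=u^m(t_m)$ denotes the numerical solution at time $t_m$. The notation $u^{m+1}(t)$ is the numerical solution as a function of $t$ up to $t_{m+1}$; on $[0,t_{k-1}]$ it is provided by a starting procedure, and for $n\ge k-1$ the scheme determines it on $[t_n,t_{n+1}]$ (continuously in time). For fixed $n$ and $0\le i\le k-1$, $\ell_i$ is the Lagrange basis polynomial $$\ell_i(s)=\prod_{0\le m\le k-1,\ m\ne i}\frac{\sum_{j=1}^m\tau_{n-j}+s}{\sum_{j=1}^m\tau_{n-j}-\sum_{j=1}^i\tau_{n-j}},$$ which takes the value $1$ at $s=t_{n-i}-t_n$ and $0$ at $s=t_{n-m}-t_n$ for $m\neq i$, $0\le m\le k-1$. Notation. $I_n^1=(t_n,t_{n+1})$, so $\|\cdot\|_{L^2(I_{n-j}^1;V^\alpha)}=\|\cdot\|_{L^2(t_{n-j},t_{n-j+1};V^\alpha)}$. $C_0^*=1$, and $C_1^*,\dots,C_{k-1}^*>0$ are constants, independent of the time steps $\tau_i$,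 $\tau$ and of $n$, $t$, such that $$\left\|1-\sum_{i=0}^{j-1}\ell_i(t-t_n)\right\|_{L^2(I_n^1)}\le C_j^*\,\tau^{1/2},\qquad 1\le j\le k-1,$$ for all $n\ge k-1$ (such constants exist by the local step-ratio bound). Set $\overline{C}_j=\sum_{l=j}^{k-1}C_l^*$ for $0\le j\le k-1$. Regularity convention. The numerical solution is understood to be regular enough in time that all norms occurring are finite and $\frac{d}{dt}E(u^{n+1}(t))=\big(\epsilon\mathcal Lu^{n+1}(t)-F(u^{n+1}(t)),\frac{du^{n+1}(t)}{dt}\big)_{\mathcal H}$ for a.e. $t\in(t_n,t_{n+1})$ with $E(u^{n+1}(t))$ absolutely continuous. *)

theory Defs
  imports "HOL-Analysis.Analysis"
begin

section \<open>Self-adjoint operators and their fractional powers\<close>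

text \<open>An unbounded operator on a Hilbert space is represented by its graph.\<close>

definition self_adjoint_graph :: "('h::real_inner \<times> 'h) set \<Rightarrow> bool" where
  "self_adjoint_graph G \<longleftrightarrow>
     closure (Domain G) = UNIV \<and>
     G = {(y, g). \<forall>(x, f)\<in>G. inner f y = inner x g}"

text \<open>
  A standard triple: the Hilbert space \<open>'x\<close> is embedded by \<open>j\<close> densely and continuously into
  \<open>'h\<close>, and \<open>'h\<close> acts on \<open>'x\<close> through the inner product of \<open>'h\<close>.
  An operator \<open>L\<close> from \<open>'x\<close> to its dual is regarded as an operator on \<open>'h\<close> with domain
  the set of all \<open>x\<close> for which \<open>L x\<close> is represented by an element of \<open>'h\<close>.
\<close>

definition standard_triple :: "('x::{real_inner,complete_space} \<Rightarrow> 'h::{real_inner,complete_space}) \<Rightarrow> bool" where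
  "standard_triple j \<longleftrightarrow> bounded_linear j \<and> inj j \<and> closure (range j) = UNIV"

definition realization :: "('x::real_inner \<Rightarrow> 'h::real_inner) \<Rightarrow> ('x \<Rightarrow> ('x \<Rightarrow>\<^sub>L real)) \<Rightarrow> ('h \<times> 'h) set" where
  "realization j L = {(j x, f) | x f. \<forall>y. blinfun_apply (L x) y = inner f (j y)}"

definition projection_measure :: "(real set \<Rightarrow> 'h::real_inner \<Rightarrow> 'h) \<Rightarrow> bool" where
  "projection_measure P \<longleftrightarrow>
     (\<forall>B\<in>sets borel. bounded_linear (P B) \<and> (\<forall>x. P B (P B x) = P B x) \<and>
        (\<forall>x y. inner (P B x) y = inner x (P B y))) \<and>
     (\<forall>x. P UNIV x = x) \<and>
     (\<forall>A x. range A \<subseteq> sets borel \<longrightarrow> disjoint_family A \<longrightarrow>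
        (\<lambda>i::nat. P (A i) x) sums P (\<Union>i. A i) x)"

text \<open>The scalar measure \<open>B \<mapsto> (P B x, x)\<close>.\<close>

definition scalar_measure :: "(real set \<Rightarrow> 'h::real_inner \<Rightarrow> 'h) \<Rightarrow> 'h \<Rightarrow> real measure" where
  "scalar_measure P x = measure_of UNIV (sets borel) (\<lambda>B. ennreal (inner (P B x) x))"

text \<open>
  The operator \<open>\<integral> g dP\<close> for a Borel function \<open>g\<close> that is nonnegative on the support of \<open>P\<close>,
  as the limit of the integrals of the usual dyadic simple functions approximating \<open>g\<close> from below.
\<close>

definition spectral_dom :: "(real set \<Rightarrow> 'h::real_inner \<Rightarrow> 'h) \<Rightarrow> (real \<Rightarrow> real) \<Rightarrow> 'h set" where
  "spectral_dom P g = {x. (\<integral>\<^sup>+ z. ennreal ((g z)\<^sup>2) \<partial>scalar_measure P x) < \<infinity>}"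

definition spectral_int :: "(real set \<Rightarrow> 'h::real_inner \<Rightarrow> 'h) \<Rightarrow> (real \<Rightarrow> real) \<Rightarrow> 'h \<Rightarrow> 'h" where
  "spectral_int P g x =
     lim (\<lambda>n. \<Sum>i<4 ^ n. (real i / 2 ^ n) *\<^sub>R P {z. real i / 2 ^ n \<le> g z \<and> g z < (real i + 1) / 2 ^ n} x)"

text \<open>\<open>P\<close> is the spectral measure of the nonnegative self-adjoint operator with graph \<open>G\<close>.\<close>

definition spectral_measure_of :: "('h::real_inner \<times> 'h) set \<Rightarrow> (real set \<Rightarrow> 'h \<Rightarrow> 'h) \<Rightarrow> bool" where
  "spectral_measure_of G P \<longleftrightarrow>
     projection_measure P \<and> (\<forall>x. P {..<0} x = 0) \<and>
     G = {(x, spectral_int P (\<lambda>z. z) x) | x. x \<in> spectral_dom P (\<lambda>z. z)}"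

text \<open>The case distinction makes the zeroth power the identity, since \<open>0 powr 0 = 0\<close>.\<close>

definition pow_fun :: "real \<Rightarrow> real \<Rightarrow> real" where
  "pow_fun s z = (if s = 0 then 1 else z powr s)"

definition frac_pow :: "(real set \<Rightarrow> 'h::real_inner \<Rightarrow> 'h) \<Rightarrow> real \<Rightarrow> 'h \<Rightarrow> 'h" where
  "frac_pow P s = spectral_int P (pow_fun s)"

section \<open>The scale of spaces and their duals\<close>

definition V :: "(real set \<Rightarrow> 'h::real_inner \<Rightarrow> 'h) \<Rightarrow> real \<Rightarrow> 'h set" where
  "V P \<alpha> = spectral_dom P (pow_fun (\<alpha> / 2))"

definition V_norm :: "(real set \<Rightarrow> 'h::real_inner \<Rightarrow> 'h) \<Rightarrow> real \<Rightarrow> 'h \<Rightarrow> real" where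
  "V_norm P \<alpha> v = norm (frac_pow P (\<alpha> / 2) v)"

text \<open>
  Elements of the dual of \<open>V P \<alpha>\<close> are functionals, of which only the values on \<open>V P \<alpha>\<close> matter;
  \<open>h :: 'h\<close> corresponds to \<open>\<lambda>w. inner h w\<close>.
\<close>

definition V_dual :: "(real set \<Rightarrow> 'h::real_inner \<Rightarrow> 'h) \<Rightarrow> real \<Rightarrow> ('h \<Rightarrow> real) set" where
  "V_dual P \<alpha> = {\<phi>.
     (\<forall>v\<in>V P \<alpha>. \<forall>w\<in>V P \<alpha>. \<phi> (v + w) = \<phi> v + \<phi> w) \<and>
     (\<forall>c. \<forall>w\<in>V P \<alpha>. \<phi> (c *\<^sub>R w) = c * \<phi> w) \<and>
     (\<exists>C. \<forall>w\<in>V P \<alpha>. \<bar>\<phi> w\<bar> \<le> C * V_norm P \<alpha> w)}"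

definition V_dual_norm :: "(real set \<Rightarrow> 'h::real_inner \<Rightarrow> 'h) \<Rightarrow> real \<Rightarrow> ('h \<Rightarrow> real) \<Rightarrow> real" where
  "V_dual_norm P \<alpha> \<phi> = (SUP w\<in>{w \<in> V P \<alpha>. V_norm P \<alpha> w \<le> 1}. \<bar>\<phi> w\<bar>)"

text \<open>
  For \<open>v \<in> V P s\<close>, the \<open>s\<close>-th power of the operator applied to \<open>v\<close>, as an element of the dual of
  \<open>V P s\<close>.
\<close>

definition pow_dual :: "(real set \<Rightarrow> 'h::real_inner \<Rightarrow> 'h) \<Rightarrow> real \<Rightarrow> 'h \<Rightarrow> ('h \<Rightarrow> real)" where
  "pow_dual P s v w = inner (frac_pow P (s / 2) v) (frac_pow P (s / 2) w)"

section \<open>Energy and right-hand side\<close>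

definition energy :: "(real set \<Rightarrow> 'h::real_inner \<Rightarrow> 'h) \<Rightarrow> real \<Rightarrow> ('h \<Rightarrow> real) \<Rightarrow> 'h \<Rightarrow> real" where
  "energy P \<epsilon> \<F> v = \<epsilon> / 2 * (norm (frac_pow P (1 / 2) v))\<^sup>2 + \<F> v"

text \<open>
  \<open>F\<close> is the negative variational derivative of \<open>\<F>\<close>.  Since \<open>F v\<close> is only defined for
  \<open>v \<in> V P \<gamma>\<close> and only acts on \<open>V P \<beta>\<close>, \<open>\<F>\<close> is considered on the intersection.
\<close>

definition neg_variational_derivative ::
    "(real set \<Rightarrow> 'h::real_inner \<Rightarrow> 'h) \<Rightarrow> real \<Rightarrow> real \<Rightarrow> ('h \<Rightarrow> real) \<Rightarrow> ('h \<Rightarrow> 'h \<Rightarrow> real) \<Rightarrow> bool" where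
  "neg_variational_derivative P \<beta> \<gamma> \<F> F \<longleftrightarrow>
     (\<forall>v \<in> V P \<beta> \<inter> V P \<gamma>. \<forall>w \<in> V P \<beta> \<inter> V P \<gamma>.
        ((\<lambda>s. \<F> (v + s *\<^sub>R w)) has_real_derivative - F v w) (at 0))"

definition lipschitz_rhs ::
    "(real set \<Rightarrow> 'h::real_inner \<Rightarrow> 'h) \<Rightarrow> real \<Rightarrow> real \<Rightarrow> real \<Rightarrow> ('h \<Rightarrow> 'h \<Rightarrow> real) \<Rightarrow> bool" where
  "lipschitz_rhs P \<beta> \<gamma> C\<^sub>L F \<longleftrightarrow>
     (\<forall>u\<in>V P \<gamma>. F u \<in> V_dual P \<beta>) \<and>
     (\<forall>u\<in>V P \<gamma>. \<forall>v\<in>V P \<gamma>. V_dual_norm P \<beta> (\<lambda>w. F u w - F v w) \<le> C\<^sub>L * V_norm P \<gamma> (u - v))"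

section \<open>Time grid\<close>

definition step :: "(nat \<Rightarrow> real) \<Rightarrow> nat \<Rightarrow> real" where
  "step T n = T (Suc n) - T n"

definition max_step :: "(nat \<Rightarrow> real) \<Rightarrow> real" where
  "max_step T = (SUP n. step T n)"

definition time_grid :: "nat \<Rightarrow> (nat \<Rightarrow> real) \<Rightarrow> bool" where
  "time_grid k T \<longleftrightarrow>
     T 0 = 0 \<and> strict_mono T \<and> bdd_above (range (step T)) \<and>
     (\<exists>\<rho>. \<forall>n. \<forall>i<k. \<forall>j<k. step T (n + i) \<le> \<rho> * step T (n + j))"

definition lagrange_basis :: "nat \<Rightarrow> (nat \<Rightarrow> real) \<Rightarrow> nat \<Rightarrow> nat \<Rightarrow> real \<Rightarrow> real" where
  "lagrange_basis k T n i s =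
     (\<Prod>m\<in>{0..k - 1} - {i}.
        ((\<Sum>j=1..m. step T (n - j)) + s) /
        ((\<Sum>j=1..m. step T (n - j)) - (\<Sum>j=1..i. step T (n - j))))"

definition interval :: "(nat \<Rightarrow> real) \<Rightarrow> nat \<Rightarrow> real set" where
  "interval T n = {T n<..<T (Suc n)}"

definition L2_on :: "real set \<Rightarrow> (real \<Rightarrow> real) \<Rightarrow> bool" where
  "L2_on I g \<longleftrightarrow> set_integrable lebesgue I (\<lambda>t. (g t)\<^sup>2)"

definition L2_norm_on :: "real set \<Rightarrow> (real \<Rightarrow> real) \<Rightarrow> real" where
  "L2_norm_on I g = sqrt (LINT t:I|lebesgue. (g t)\<^sup>2)"

definition C_bar :: "nat \<Rightarrow> (nat \<Rightarrow> real) \<Rightarrow> nat \<Rightarrow> real" where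
  "C_bar k Cs j = (\<Sum>l=j..k - 1. Cs l)"

section \<open>The numerical solution\<close>

text \<open>
  \<open>u m\<close> is the numerical solution as a function of time on \<open>{0..T m}\<close>, and \<open>u m (T m)\<close> is its
  value at the node \<open>T m\<close>.
\<close>

abbreviation time_deriv :: "(real \<Rightarrow> 'h::real_normed_vector) \<Rightarrow> real \<Rightarrow> 'h" where
  "time_deriv u t \<equiv> vector_derivative u (at t)"

definition absolutely_continuous_on :: "real set \<Rightarrow> (real \<Rightarrow> 'a::real_normed_vector) \<Rightarrow> bool" where
  "absolutely_continuous_on S f \<longleftrightarrow>
     (\<forall>e>0. \<exists>d>0. \<forall>D. D division_of \<Union>D \<longrightarrow> \<Union>D \<subseteq> S \<longrightarrow> (\<Sum>K\<in>D. Sup K - Inf K) < d \<longrightarrow>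
        (\<Sum>K\<in>D. norm (f (Sup K) - f (Inf K))) < e)"

text \<open>
  The time derivative commutes with the fractional power, so the stabilization term is
  \<open>A \<tau>\<^sup>k\<close> times the power \<open>p\<close> of the operator applied to the time derivative.  The values \<open>F (u ...)\<close>
  lie in the dual of \<open>V P \<beta>\<close>, so the equation holds in the dual of \<open>V P 1 \<inter> V P p\<close>.
\<close>

definition scheme ::
    "(real set \<Rightarrow> 'h::real_inner \<Rightarrow> 'h) \<Rightarrow> real \<Rightarrow> real \<Rightarrow> real \<Rightarrow> ('h \<Rightarrow> 'h \<Rightarrow> real) \<Rightarrow>
     nat \<Rightarrow> (nat \<Rightarrow> real) \<Rightarrow> (nat \<Rightarrow> real \<Rightarrow> 'h) \<Rightarrow> bool" where
  "scheme P \<epsilon> A p F k T u \<longleftrightarrow>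
     (\<forall>n\<ge>k - 1. AE t in lborel. t \<in> interval T n \<longrightarrow>
        (\<forall>w \<in> V P 1 \<inter> V P p.
           inner (time_deriv (u (n + 1)) t) w
           + \<epsilon> * pow_dual P 1 (u (n + 1) t) w
           + A * max_step T ^ k * pow_dual P p (time_deriv (u (n + 1)) t) w
           = (\<Sum>i=0..k - 1. lagrange_basis k T n i (t - T n) * F (u (n - i) (T (n - i))) w))) \<and>
     (\<forall>n. \<forall>t\<in>{0..T n}. u (n + 1) t = u n t)"

text \<open>
  The regularity in time: the node values lie in the domain of \<open>F\<close>, all norms in the modified
  energies are finite, the terms of the scheme make sense, and the energy
  satisfies the chain rule almost everywhere and is absolutely continuous on each step.
  The modified energies with index at least \<open>k\<close> only involve the intervals with index at least 1.
\<close>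

definition regular_in_time ::
    "(real set \<Rightarrow> 'h::real_inner \<Rightarrow> 'h) \<Rightarrow> real \<Rightarrow> real \<Rightarrow> real \<Rightarrow> ('h \<Rightarrow> real) \<Rightarrow> ('h \<Rightarrow> 'h \<Rightarrow> real) \<Rightarrow>
     nat \<Rightarrow> (nat \<Rightarrow> real) \<Rightarrow> (nat \<Rightarrow> real \<Rightarrow> 'h) \<Rightarrow> bool" where
  "regular_in_time P \<epsilon> \<gamma> p \<F> F k T u \<longleftrightarrow>
     (\<forall>m. u m (T m) \<in> V P \<gamma>) \<and>
     (\<forall>m\<ge>1.
        absolutely_continuous_on {T m..T (m + 1)} (u (m + 1)) \<and>
        (AE t in lborel. t \<in> interval T m \<longrightarrow>
           u (m + 1) differentiable (at t) \<and> time_deriv (u (m + 1)) t \<in> V P p) \<and>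
        L2_on (interval T m) (\<lambda>t. norm (time_deriv (u (m + 1)) t)) \<and>
        L2_on (interval T m) (\<lambda>t. V_norm P p (time_deriv (u (m + 1)) t))) \<and>
     (\<forall>n\<ge>k - 1.
        (\<forall>t\<in>{T n..T (n + 1)}. u (n + 1) t \<in> V P 1 \<inter> V P p) \<and>
        (AE t in lborel. t \<in> interval T n \<longrightarrow> time_deriv (u (n + 1)) t \<in> V P 1) \<and>
        absolutely_continuous_on {T n..T (n + 1)} (\<lambda>t. energy P \<epsilon> \<F> (u (n + 1) t)) \<and>
        (AE t in lborel. t \<in> interval T n \<longrightarrow>
           ((\<lambda>t. energy P \<epsilon> \<F> (u (n + 1) t)) has_real_derivative
              \<epsilon> * pow_dual P 1 (u (n + 1) t) (time_deriv (u (n + 1)) t)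
              - F (u (n + 1) t) (time_deriv (u (n + 1)) t)) (at t)))"

definition modified_energy ::
    "(real set \<Rightarrow> 'h::real_inner \<Rightarrow> 'h) \<Rightarrow> real \<Rightarrow> ('h \<Rightarrow> real) \<Rightarrow> real \<Rightarrow> real \<Rightarrow> real \<Rightarrow> real \<Rightarrow>
     (nat \<Rightarrow> real) \<Rightarrow> nat \<Rightarrow> (nat \<Rightarrow> real) \<Rightarrow> (nat \<Rightarrow> real \<Rightarrow> 'h) \<Rightarrow> nat \<Rightarrow> real" where
  "modified_energy P \<epsilon> \<F> C\<^sub>L C\<^sub>3 C\<^sub>4 p Cs k T u n =
     energy P \<epsilon> \<F> (u n (T n))
     + C\<^sub>L * C\<^sub>3 * (\<Sum>j=1..k - 1. C_bar k Cs j *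
         (L2_norm_on (interval T (n - j)) (\<lambda>t. norm (time_deriv (u (n - j + 1)) t)))\<^sup>2)
     + C\<^sub>L * C\<^sub>4 * (\<Sum>j=1..k - 1. C_bar k Cs j * max_step T ^ k *
         (L2_norm_on (interval T (n - j)) (\<lambda>t. V_norm P p (time_deriv (u (n - j + 1)) t)))\<^sup>2)"

text \<open>
  The two kinds of expressions in the constants for an exponent \<open>a\<close> (one of \<open>\<beta>\<close>, \<open>\<gamma>\<close>).
  For \<open>a = 0\<close> the second one is read as the limit \<open>a \<rightarrow> 0+\<close>, which is 0 for \<open>C \<ge> 1\<close> and infinite,
  hence excluded, for \<open>C < 1\<close>.
\<close>

definition young_coeff :: "real \<Rightarrow> real \<Rightarrow> real \<Rightarrow> real" where
  "young_coeff p a C = (1 - a / p) * C powr (1 / (1 - a / p))"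

definition stab_coeff :: "real \<Rightarrow> real \<Rightarrow> real \<Rightarrow> real" where
  "stab_coeff p a C = (if a = 0 then 0 else a / (2 * p) * C powr (- p / a))"

definition admissible_const :: "real \<Rightarrow> real \<Rightarrow> bool" where
  "admissible_const a C \<longleftrightarrow> C > 0 \<and> (a = 0 \<longrightarrow> C \<ge> 1)"

end

theory Submission
  imports Defs
begin

text \<open>
  The scheme is tested with the time derivative \<open>u'\<close> of the numerical solution. With the chain rule
  for the energy this gives, for almost every \<open>t\<close> in a time step,
  \<open>dE/dt = - \<parallel>u'\<parallel>\<^sup>2 - A \<tau>\<^sup>k \<parallel>u'\<parallel>\<^sup>2\<^bsub>V p\<^esub> + \<langle>extrapolated F - F u, u'\<rangle>\<close>.
  The Lagrange weights have sum 1 (\<open>sum_lagrange_basis_eq_1\<close>), so Abel summation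
  (\<open>sum_by_parts_partition\<close>) turns the extrapolation error into differences of \<open>F\<close> between
  consecutive nodes, with coefficients \<open>1 - (\<Sum>i<j. \<ell>\<^sub>i)\<close>. The Lipschitz condition bounds these by the
  product of the norm in \<open>V \<gamma>\<close> of an increment of \<open>u\<close> and the norm of \<open>u'\<close> in \<open>V \<beta>\<close>.

  An increment is an integral of \<open>u'\<close> over one step, which gains a factor \<open>\<tau>\<^sup>1\<^sup>/\<^sup>2\<close>; integrating the
  coefficients gains another one. The resulting \<open>\<tau>\<close> is split as
  \<open>\<tau> = (\<tau>\<^sup>k) powr (\<gamma> / (2 p)) * (\<tau>\<^sup>k) powr (\<beta> / (2 p))\<close>, by the choice of \<open>p\<close>, and each factor is
  absorbed by its norm: interpolation and Young's inequality (\<open>V_norm_young_stab\<close>) bound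
  \<open>(\<tau>\<^sup>k) powr (a / p) \<parallel>v\<parallel>\<^sup>2\<^bsub>V a\<^esub>\<close> by a combination of \<open>\<parallel>v\<parallel>\<^sup>2\<close> and \<open>\<tau>\<^sup>k \<parallel>v\<parallel>\<^sup>2\<^bsub>V p\<^esub>\<close>. The contributions of
  the current step are controlled by the dissipation, and those of earlier steps telescope with the
  memory terms of the modified energy (\<open>sum_C_bar_telescope\<close>).

  Two analytic facts support this computation. The energy and the solution are only absolutely
  continuous, so a version of the fundamental theorem of calculus for such functions is needed
  (\<open>absolutely_continuous_increment_le_integral\<close>). The fractional powers are limits of
  dyadic approximations; these converge, and the squared norm of the limit is the integral of the
  squared multiplier against the scalar spectral measure (\<open>spectral_approx_tendsto\<close>,
  \<open>norm_spectral_int\<close>), which reduces every inequality between norms of the scale to an inequality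
  between real functions.
\<close>

section \<open>Increments of absolutely continuous functions\<close>

text \<open>
  Absolute continuity speaks of divisions, whereas gauges produce tagged divisions, in which the same
  interval may carry several tags. That can only happen for degenerate intervals, and these do not
  contribute to the sum.
\<close>

lemma sum_snd_tagged_partial_division:
  fixes h :: "real \<Rightarrow> 'a::real_normed_vector"
  assumes "p tagged_partial_division_of i"
  shows "(\<Sum>(x, K)\<in>p. norm (h (Sup K) - h (Inf K))) = (\<Sum>K\<in>snd ` p. norm (h (Sup K) - h (Inf K)))"
proof -
  have zero: "norm (h (Sup K) - h (Inf K)) = 0" if "(x, K) \<in> p" "(y, K) \<in> p" "x \<noteq> y" for x y K
  proof -
    obtain c d where K: "K = cbox c d" using assms \<open>(x, K) \<in> p\<close> by (meson tagged_partial_division_ofD(4))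
    have "interior K \<inter> interior K = {}"
      using assms that by (meson tagged_partial_division_ofD(5) prod.inject)
    then have "box c d = {}" using K by (metis Int_absorb interior_cbox)
    moreover have "x \<in> K" using assms that(1) by (meson tagged_partial_division_ofD(2))
    ultimately have "c = d" using K by auto
    then show ?thesis using K by auto
  qed
  have "(\<Sum>K\<in>snd ` p. norm (h (Sup K) - h (Inf K))) = (\<Sum>z\<in>p. norm (h (Sup (snd z)) - h (Inf (snd z))))"
  proof (subst sum.reindex_nontrivial)
    show "finite p" using assms by (meson tagged_partial_division_ofD(1))
  next
    fix z z' assume *: "z \<in> p" "z' \<in> p" "z \<noteq> z'" "snd z = snd z'"
    then show "norm (h (Sup (snd z)) - h (Inf (snd z))) = 0"
      using zero[of "fst z" "snd z" "fst z'"] by (metis prod.collapse)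
  qed (simp add: o_def)
  then show ?thesis by (simp add: case_prod_beta)
qed

text \<open>
  The one-sided fundamental theorem of calculus for absolutely continuous functions. The
  derivative enters through an integrable upper bound, the form in which the energy estimate
  provides it. Choose a gauge that is so fine that intervals tagged outside the null set satisfy the
  straddle estimate for the derivative and give a good Riemann sum of \<open>\<psi>\<close>, and that intervals
  tagged in the null set lie in an open set of small measure. Absolute continuity makes the total
  increment over the latter small.
\<close>

lemma absolutely_continuous_increment_le_integral:
  fixes f \<psi> :: "real \<Rightarrow> real"
  assumes ab: "a \<le> b" and ac: "absolutely_continuous_on {a..b} f" and N: "negligible N"
    and \<psi>: "\<psi> integrable_on {a..b}"
    and der: "\<And>t. t \<in> {a..b} - N \<Longrightarrow> \<exists>D\<le>\<psi> t. (f has_real_derivative D) (at t)"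
  shows "f b - f a \<le> integral {a..b} \<psi>"
proof -
  \<comment> \<open>Setting \<open>\<psi>\<close> to zero on the null set removes the intervals tagged there from the Riemann sums.\<close>
  define \<phi> where "\<phi> t = (if t \<in> N then 0 else \<psi> t)" for t
  have \<phi>: "(\<phi> has_integral integral {a..b} \<psi>) {a..b}"
    by (rule has_integral_spike[OF N _ integrable_integral[OF \<psi>]]) (auto simp: \<phi>_def)
  have key: "f b - f a \<le> integral {a..b} \<psi> + e * (2 + (b - a))" if e: "e > 0" for e
  proof -
    obtain g1 where g1: "gauge g1"
      and g1p: "\<And>p. p tagged_division_of {a..b} \<Longrightarrow> g1 fine p \<Longrightarrow>
        norm ((\<Sum>(x,K)\<in>p. measure lborel K *\<^sub>R \<phi> x) - integral {a..b} \<psi>) < e"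
      using \<phi>[unfolded has_integral_real, rule_format, OF e] by auto
    obtain d where d: "d > 0" and dac: "\<And>D. D division_of \<Union>D \<Longrightarrow> \<Union>D \<subseteq> {a..b} \<Longrightarrow>
        (\<Sum>K\<in>D. Sup K - Inf K) < d \<Longrightarrow> (\<Sum>K\<in>D. norm (f (Sup K) - f (Inf K))) < e"
      using ac e unfolding absolutely_continuous_on_def by blast
    have Nl: "N \<in> null_sets lebesgue" using N negligible_iff_null_sets by blast
    obtain U where U: "open U" "N \<subseteq> U" "U - N \<in> lmeasurable" "emeasure lebesgue (U - N) < ennreal (d/2)"
      using sets_lebesgue_outer_open[of N "d/2"] d Nl by (metis half_gt_zero null_setsD2)
    have Ueq: "U = (U - N) \<union> N" using U(2) by blast
    have Um: "U \<in> lmeasurable" 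
      using U(3) N Ueq by (metis fmeasurable.Un negligible_imp_measurable)
    have "emeasure lebesgue U = emeasure lebesgue (U - N)"
      using Nl Um by (metis emeasure_Diff_null_set fmeasurableD)
    then have "measure lebesgue U \<le> d/2"
      using U(4) d by (metis measure_def enn2real_leI less_eq_real_def half_gt_zero order_less_imp_le)
    then have Ud: "measure lebesgue U < d" using d by linarith
    obtain D where D: "\<And>t. t \<in> {a..b} - N \<Longrightarrow> D t \<le> \<psi> t \<and> (f has_real_derivative D t) (at t)"
      using der by metis
    have "\<exists>r>0. x \<in> {a..b} - N \<longrightarrow> (\<forall>y. \<bar>y - x\<bar> < r \<longrightarrow> \<bar>f y - f x - D x * (y - x)\<bar> \<le> e * \<bar>y - x\<bar>)" for x
    proof (cases "x \<in> {a..b} - N")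
      case True
      then have "(f has_derivative (\<lambda>h. D x * h)) (at x)"
        using D[OF True] by (simp add: has_field_derivative_def)
      then show ?thesis using e unfolding has_derivative_at_alt by fastforce
    qed (auto intro: exI[of _ 1])
    then obtain r where r: "\<And>x. r x > 0"
      and rD: "\<And>x y. x \<in> {a..b} - N \<Longrightarrow> \<bar>y - x\<bar> < r x \<Longrightarrow> \<bar>f y - f x - D x * (y - x)\<bar> \<le> e * \<bar>y - x\<bar>"
      by metis
    define g where "g x = g1 x \<inter> (if x \<in> N then U else ball x (r x))" for x
    have "gauge g" using g1 U(1,2) r unfolding g_def gauge_def by auto
    then obtain p where p: "p tagged_division_of {a..b}" and gp: "g fine p"
      using fine_division_exists_real by blast
    have g1fine: "g1 fine p" using gp unfolding fine_def g_def by auto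
    define pN where "pN = {z \<in> p. fst z \<in> N}"
    have fin: "finite p" using p by blast
    have sub: "pN \<subseteq> p" unfolding pN_def by auto
    have partN: "pN tagged_partial_division_of {a..b}"
      using tagged_partial_division_subset[OF _ sub] p unfolding tagged_division_of_def by simp
    have divN: "(snd ` pN) division_of \<Union>(snd ` pN)"
      using partN by (rule partial_division_of_tagged_division)
    have subU: "\<Union>(snd ` pN) \<subseteq> U"
    proof (rule Union_least)
      fix K assume "K \<in> snd ` pN"
      then obtain x where x: "(x, K) \<in> p" "x \<in> N" unfolding pN_def by auto
      then have "K \<subseteq> g x" using gp unfolding fine_def by blast
      then show "K \<subseteq> U" using x(2) unfolding g_def by auto
    qed
    have subab: "\<Union>(snd ` pN) \<subseteq> {a..b}"
      using p sub by (auto dest!: tagged_division_ofD(3))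
    have KInt: "\<exists>c d. K = {c..d} \<and> c \<le> x \<and> x \<le> d \<and> Sup K = d \<and> Inf K = c \<and> measure lborel K = d - c \<and> {c..d} \<subseteq> {a..b}"
      if "(x, K) \<in> p" for x K
    proof -
      obtain c d where K: "K = {c..d}" using tagged_division_ofD(4)[OF p \<open>(x, K) \<in> p\<close>] by auto
      have "x \<in> K" using that tagged_division_ofD(2)[OF p] by blast
      moreover have "K \<subseteq> {a..b}" using that tagged_division_ofD(3)[OF p] by blast
      ultimately show ?thesis using K by auto
    qed
    have "(\<Sum>K\<in>snd ` pN. Sup K - Inf K) = (\<Sum>K\<in>snd ` pN. measure lebesgue K)"
    proof (rule sum.cong[OF refl])
      fix K assume "K \<in> snd ` pN"
      then obtain x where "(x, K) \<in> p" using sub by auto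
      from KInt[OF this] obtain c d where "K = {c..d}" "c \<le> d" "Sup K = d" "Inf K = c" by auto
      then show "Sup K - Inf K = measure lebesgue K" by simp
    qed
    also have "\<dots> = measure lebesgue (\<Union>(snd ` pN))"
      by (rule content_division[OF divN])
    also have "\<dots> \<le> measure lebesgue U"
      using lmeasurable_division[OF divN] by (intro measure_mono_fmeasurable[OF subU _ Um]) auto
    finally have "(\<Sum>K\<in>snd ` pN. norm (f (Sup K) - f (Inf K))) < e"
      using dac[OF divN subab] Ud by linarith
    then have sN: "(\<Sum>(x,K)\<in>pN. norm (f (Sup K) - f (Inf K))) < e"
      using sum_snd_tagged_partial_division[OF partN, of f] by simp
    have sN': "(\<Sum>(x,K)\<in>pN. f (Sup K) - f (Inf K)) \<le> (\<Sum>(x,K)\<in>pN. norm (f (Sup K) - f (Inf K)))"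
      by (rule sum_mono) auto
    have pt: "f (Sup K) - f (Inf K) \<le> measure lborel K *\<^sub>R \<phi> x + e * (Sup K - Inf K)" if xK: "(x, K) \<in> p - pN" for x K
    proof -
      obtain c d where K: "K = {c..d}" "c \<le> x" "x \<le> d" "Sup K = d" "Inf K = c" "measure lborel K = d - c" "{c..d} \<subseteq> {a..b}"
        using KInt xK by blast
      have xN: "x \<notin> N" using xK unfolding pN_def by auto
      have xab: "x \<in> {a..b} - N" using K xN by auto
      have "K \<subseteq> ball x (r x)" using fineD[OF gp, of x K] xK xN unfolding g_def by auto
      moreover have "c \<in> K" "d \<in> K" using K(1-3) by auto
      ultimately have cd: "\<bar>c - x\<bar> < r x" "\<bar>d - x\<bar> < r x" by (auto simp: dist_real_def)
      have "\<bar>f d - f x - D x * (d - x)\<bar> \<le> e * (d - x)" "\<bar>f c - f x - D x * (c - x)\<bar> \<le> e * (x - c)"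
        using rD[OF xab cd(1)] rD[OF xab cd(2)] K(2,3) by auto
      then have "f d - f c \<le> D x * (d - c) + e * (d - c)" by (simp add: algebra_simps abs_le_iff)
      moreover have "D x * (d - c) \<le> \<psi> x * (d - c)" using D[OF xab] K(2,3) by (intro mult_right_mono) auto
      ultimately show ?thesis using K xN by (simp add: \<phi>_def mult.commute)
    qed
    have zN: "(\<Sum>(x,K)\<in>pN. measure lborel K *\<^sub>R \<phi> x) = 0"
      by (rule sum.neutral) (auto simp: pN_def \<phi>_def)
    have lN: "(\<Sum>(x,K)\<in>pN. Sup K - Inf K) \<ge> 0"
    proof (rule sum_nonneg)
      fix z assume "z \<in> pN"
      then have "(fst z, snd z) \<in> p" using sub by auto
      from KInt[OF this] show "0 \<le> (case z of (x, K) \<Rightarrow> Sup K - Inf K)" by (auto simp: case_prod_beta)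
    qed
    have "f b - f a = (\<Sum>(x,K)\<in>p. f (Sup K) - f (Inf K))"
      using additive_tagged_division_1[OF ab p, of f] by simp
    also have "\<dots> = (\<Sum>(x,K)\<in>p - pN. f (Sup K) - f (Inf K)) + (\<Sum>(x,K)\<in>pN. f (Sup K) - f (Inf K))"
      by (rule sum.subset_diff[OF sub fin])
    also have "\<dots> \<le> (\<Sum>(x,K)\<in>p - pN. measure lborel K *\<^sub>R \<phi> x + e * (Sup K - Inf K)) + e"
    proof (rule add_mono)
      show "(\<Sum>(x,K)\<in>p - pN. f (Sup K) - f (Inf K)) \<le> (\<Sum>(x,K)\<in>p - pN. measure lborel K *\<^sub>R \<phi> x + e * (Sup K - Inf K))"
        by (rule sum_mono) (use pt in auto)
    qed (use sN sN' in linarith)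
    also have "(\<Sum>(x,K)\<in>p - pN. measure lborel K *\<^sub>R \<phi> x + e * (Sup K - Inf K)) =
       (\<Sum>(x,K)\<in>p - pN. measure lborel K *\<^sub>R \<phi> x) + e * (\<Sum>(x,K)\<in>p - pN. Sup K - Inf K)"
      by (simp add: case_prod_beta sum.distrib sum_distrib_left)
    also have "(\<Sum>(x,K)\<in>p - pN. measure lborel K *\<^sub>R \<phi> x) = (\<Sum>(x,K)\<in>p. measure lborel K *\<^sub>R \<phi> x)"
      using sum.subset_diff[OF sub fin, of "\<lambda>(x,K). measure lborel K *\<^sub>R \<phi> x"] zN by simp
    also have "(\<Sum>(x,K)\<in>p - pN. Sup K - Inf K) \<le> (\<Sum>(x,K)\<in>p. Sup K - Inf K)"
      using sum.subset_diff[OF sub fin, of "\<lambda>(x,K). Sup K - Inf K"] lN by simp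
    also have "(\<Sum>(x,K)\<in>p. Sup K - Inf K) = b - a"
      using additive_tagged_division_1[OF ab p, of "\<lambda>x. x"] by simp
    also have "(\<Sum>(x,K)\<in>p. measure lborel K *\<^sub>R \<phi> x) \<le> integral {a..b} \<psi> + e"
      using g1p[OF p g1fine] by (simp add: abs_less_iff)
    finally show ?thesis using e by (simp add: algebra_simps)
  qed
  show ?thesis
  proof (rule field_le_epsilon)
    fix e :: real assume "e > 0"
    then show "f b - f a \<le> integral {a..b} \<psi> + e"
    proof -
      have "2 + (b - a) > 0" using ab by simp
      then show ?thesis using key[of "e / (2 + (b - a))"] \<open>e > 0\<close> by simp
    qed
  qed
qed

lemma absolutely_continuous_on_bounded_linear:
  assumes B: "bounded_linear B" and f: "absolutely_continuous_on S f"
  shows "absolutely_continuous_on S (\<lambda>t. B (f t))"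
  unfolding absolutely_continuous_on_def
proof (intro allI impI)
  fix e :: real assume "e > 0"
  obtain K where K: "K > 0" "\<And>x. norm (B x) \<le> norm x * K"
    using bounded_linear.pos_bounded[OF B] by blast
  obtain d where d: "d > 0" and dac: "\<And>D. D division_of \<Union>D \<Longrightarrow> \<Union>D \<subseteq> S \<Longrightarrow>
      (\<Sum>K\<in>D. Sup K - Inf K) < d \<Longrightarrow> (\<Sum>K\<in>D. norm (f (Sup K) - f (Inf K))) < e / K"
    using f divide_pos_pos[OF \<open>e > 0\<close> K(1)] unfolding absolutely_continuous_on_def by blast
  show "\<exists>d>0. \<forall>D. D division_of \<Union>D \<longrightarrow> \<Union>D \<subseteq> S \<longrightarrow> (\<Sum>K\<in>D. Sup K - Inf K) < d \<longrightarrow>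
        (\<Sum>K\<in>D. norm (B (f (Sup K)) - B (f (Inf K)))) < e"
  proof (intro exI[of _ d] conjI d allI impI)
    fix D assume *: "D division_of \<Union>D" "\<Union>D \<subseteq> S" "(\<Sum>K\<in>D. Sup K - Inf K) < d"
    have "(\<Sum>I\<in>D. norm (B (f (Sup I)) - B (f (Inf I)))) \<le> (\<Sum>I\<in>D. norm (f (Sup I) - f (Inf I)) * K)"
      using K(2) linear_diff[OF bounded_linear.linear[OF B]] by (metis (no_types, lifting) sum_mono)
    also have "\<dots> < e" using dac[OF *] K(1) by (simp add: sum_distrib_right[symmetric] pos_less_divide_eq)
    finally show "(\<Sum>K\<in>D. norm (B (f (Sup K)) - B (f (Inf K)))) < e" .
  qed
qed

text \<open>
  The vector-valued case reduces to the scalar one by testing the function with its own increment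
  \<open>f b - f a\<close>.
\<close>

lemma norm_absolutely_continuous_increment_le_integral:
  fixes f :: "real \<Rightarrow> 'h::real_inner"
  assumes ab: "a \<le> b" and ac: "absolutely_continuous_on {a..b} f" and N: "negligible N"
    and \<phi>: "\<phi> integrable_on {a..b}"
    and der: "\<And>t. t \<in> {a..b} - N \<Longrightarrow> \<exists>D. norm D \<le> \<phi> t \<and> (f has_vector_derivative D) (at t)"
  shows "norm (f b - f a) \<le> integral {a..b} \<phi>"
proof -
  define v where "v = f b - f a"
  have "inner (f b) v - inner (f a) v \<le> integral {a..b} (\<lambda>t. \<phi> t * norm v)"
  proof (rule absolutely_continuous_increment_le_integral[OF ab _ N])
    show "absolutely_continuous_on {a..b} (\<lambda>t. inner (f t) v)"
      by (rule absolutely_continuous_on_bounded_linear[OF bounded_linear_inner_left ac])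
    show "(\<lambda>t. \<phi> t * norm v) integrable_on {a..b}" using \<phi> by (rule integrable_on_mult_left)
    fix t assume "t \<in> {a..b} - N"
    then obtain D where D: "norm D \<le> \<phi> t" "(f has_vector_derivative D) (at t)" using der by blast
    have "inner D v \<le> \<phi> t * norm v"
      using norm_cauchy_schwarz[of D v] mult_right_mono[OF D(1), of "norm v"] by simp
    moreover have "((\<lambda>t. inner (f t) v) has_real_derivative inner D v) (at t)"
      using bounded_linear.has_vector_derivative[OF bounded_linear_inner_left D(2), of v]
      by (simp add: has_real_derivative_iff_has_vector_derivative)
    ultimately show "\<exists>D\<le>\<phi> t * norm v. ((\<lambda>t. inner (f t) v) has_real_derivative D) (at t)" by blast
  qed
  then have "norm v * norm v \<le> integral {a..b} \<phi> * norm v"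
    by (simp add: v_def inner_diff_left[symmetric] dot_square_norm power2_eq_square)
  moreover have "integral {a..b} \<phi> \<ge> 0" if "v = 0"
  proof -
    have "0 - 0 \<le> integral {a..b} \<phi>"
    proof (rule absolutely_continuous_increment_le_integral[OF ab _ N \<phi>, of "\<lambda>_. 0"])
      show "absolutely_continuous_on {a..b} (\<lambda>_. 0::real)"
        unfolding absolutely_continuous_on_def by (auto intro: exI[of _ 1])
      show "\<exists>D\<le>\<phi> t. ((\<lambda>_. 0) has_real_derivative D) (at t)" if "t \<in> {a..b} - N" for t
      proof -
        have "0 \<le> \<phi> t" using der[OF that] norm_ge_zero order_trans by blast
        then show ?thesis using DERIV_const by blast
      qed
    qed
    then show ?thesis by simp
  qed
  ultimately show ?thesis unfolding v_def[symmetric]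
    by (cases "v = 0") auto
qed

lemma AE_lborel_negligible:
  assumes "AE t in lborel. Q t"
  obtains N where "negligible N" "\<And>t. t \<notin> N \<Longrightarrow> Q t"
proof -
  obtain N where "N \<in> null_sets lborel" "{t \<in> space lborel. \<not> Q t} \<subseteq> N"
    using assms unfolding eventually_ae_filter by blast
  then show thesis
    by (intro that[of N]) (auto simp: negligible_iff_null_sets null_sets_completionI)
qed

lemma increment_le_set_integral:
  fixes f \<psi> :: "real \<Rightarrow> real"
  assumes ab: "a \<le> b" and ac: "absolutely_continuous_on {a..b} f"
    and der: "AE t in lborel. t \<in> {a<..<b} \<longrightarrow> (\<exists>D\<le>\<psi> t. (f has_real_derivative D) (at t))"
    and \<psi>: "set_integrable lebesgue {a<..<b} \<psi>"
  shows "f b - f a \<le> (LINT t:{a<..<b}|lebesgue. \<psi> t)"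
proof -
  obtain N where N: "negligible N"
    "\<And>t. t \<notin> N \<Longrightarrow> t \<in> {a<..<b} \<longrightarrow> (\<exists>D\<le>\<psi> t. (f has_real_derivative D) (at t))"
    by (rule AE_lborel_negligible[OF der]) (rule that)
  have neg: "negligible (N \<union> {a, b})"
    using N(1) by (simp add: negligible_Un)
  have hi: "(\<psi> has_integral (LINT t:{a<..<b}|lebesgue. \<psi> t)) {a..b}"
    using has_integral_set_lebesgue[OF \<psi>] by (simp add: has_integral_Icc_iff_Ioo)
  have "f b - f a \<le> integral {a..b} \<psi>"
    by (rule absolutely_continuous_increment_le_integral[OF ab ac neg])
      (use hi N(2) in \<open>auto simp: has_integral_integrable\<close>)
  then show ?thesis using hi by (simp add: integral_unique)
qed

lemma absolutely_continuous_on_subset: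
  assumes "absolutely_continuous_on S f" "R \<subseteq> S"
  shows "absolutely_continuous_on R f"
  unfolding absolutely_continuous_on_def
proof (intro allI impI)
  fix e :: real assume "e > 0"
  then obtain d where d: "d > 0" "\<forall>D. D division_of \<Union>D \<longrightarrow> \<Union>D \<subseteq> S \<longrightarrow> (\<Sum>K\<in>D. Sup K - Inf K) < d \<longrightarrow>
      (\<Sum>K\<in>D. norm (f (Sup K) - f (Inf K))) < e"
    using assms(1) unfolding absolutely_continuous_on_def by auto
  show "\<exists>d>0. \<forall>D. D division_of \<Union>D \<longrightarrow> \<Union>D \<subseteq> R \<longrightarrow> (\<Sum>K\<in>D. Sup K - Inf K) < d \<longrightarrow>
      (\<Sum>K\<in>D. norm (f (Sup K) - f (Inf K))) < e"
    using d assms(2) by (intro exI[of _ d]) (simp add: subset_trans[OF _ assms(2)])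
qed

lemma norm_increment_le_set_integral:
  fixes f :: "real \<Rightarrow> 'h::real_inner"
  assumes ab: "a \<le> b" and c: "c \<in> {a..b}" and ac: "absolutely_continuous_on {a..b} f"
    and der: "AE t in lborel. t \<in> {a<..<b} \<longrightarrow> (\<exists>D. norm D \<le> \<phi> t \<and> (f has_vector_derivative D) (at t))"
    and \<phi>: "set_integrable lebesgue {a<..<b} \<phi>" and \<phi>0: "\<And>t. 0 \<le> \<phi> t"
  shows "norm (f c - f a) \<le> (LINT t:{a<..<b}|lebesgue. \<phi> t)"
proof -
  obtain N where N: "negligible N"
    "\<And>t. t \<notin> N \<Longrightarrow> t \<in> {a<..<b} \<longrightarrow> (\<exists>D. norm D \<le> \<phi> t \<and> (f has_vector_derivative D) (at t))"
    by (rule AE_lborel_negligible[OF der]) (rule that)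
  have neg: "negligible (N \<union> {a, b})"
    using N(1) by (simp add: negligible_Un)
  have hi: "(\<phi> has_integral (LINT t:{a<..<b}|lebesgue. \<phi> t)) {a..b}"
    using has_integral_set_lebesgue[OF \<phi>] by (simp add: has_integral_Icc_iff_Ioo)
  then have int: "\<phi> integrable_on {a..b}" by (rule has_integral_integrable)
  then have intc: "\<phi> integrable_on {a..c}" using c by (auto intro: integrable_subinterval_real)
  have "absolutely_continuous_on {a..c} f"
    using c by (intro absolutely_continuous_on_subset[OF ac]) auto
  then have "norm (f c - f a) \<le> integral {a..c} \<phi>"
    by (rule norm_absolutely_continuous_increment_le_integral[rotated, OF _ neg intc]) (use c N(2) in auto)
  also have "\<dots> \<le> integral {a..b} \<phi>"
    using c int intc \<phi>0 by (intro integral_subset_le) auto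
  finally show ?thesis using hi by (simp add: integral_unique)
qed

section \<open>The Cauchy--Schwarz inequality on a time step\<close>

text \<open>
  The quadratic polynomial \<open>l \<mapsto> \<integral> (f + l g)\<^sup>2\<close> is nonnegative, hence its discriminant is not positive.
\<close>

lemma integral_Cauchy_Schwarz:
  fixes f g :: "'a \<Rightarrow> real"
  assumes f [measurable]: "f \<in> borel_measurable M" and g [measurable]: "g \<in> borel_measurable M"
    and f2: "integrable M (\<lambda>x. (f x)\<^sup>2)" and g2: "integrable M (\<lambda>x. (g x)\<^sup>2)"
  shows "integrable M (\<lambda>x. f x * g x)"
    and "(LINT x|M. f x * g x) \<le> sqrt (LINT x|M. (f x)\<^sup>2) * sqrt (LINT x|M. (g x)\<^sup>2)"
proof -
  have am: "\<bar>a * b\<bar> \<le> a\<^sup>2 + b\<^sup>2" for a b :: real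
    using zero_le_power2[of "a - b"] zero_le_power2[of "a + b"] zero_le_power2[of a] zero_le_power2[of b]
    unfolding power2_diff power2_sum abs_le_iff by linarith
  show fg: "integrable M (\<lambda>x. f x * g x)"
    by (rule Bochner_Integration.integrable_bound[OF Bochner_Integration.integrable_add[OF f2 g2]]) (use am in auto)
  define A B C where "A = (LINT x|M. (f x)\<^sup>2)" and "B = (LINT x|M. (g x)\<^sup>2)" and "C = (LINT x|M. f x * g x)"
  \<comment> \<open>The polynomial is later evaluated at its minimum, or, if it is affine, far out where it would be negative.\<close>
  have quad: "0 \<le> A + 2 * l * C + l\<^sup>2 * B" for l
  proof -
    have "0 \<le> (LINT x|M. (f x + l * g x)\<^sup>2)" by simp
    also have "(\<lambda>x. (f x + l * g x)\<^sup>2) = (\<lambda>x. (f x)\<^sup>2 + (2 * l) * (f x * g x) + l\<^sup>2 * (g x)\<^sup>2)"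
      by (simp add: power2_eq_square algebra_simps)
    also have "(LINT x|M. (f x)\<^sup>2 + (2 * l) * (f x * g x) + l\<^sup>2 * (g x)\<^sup>2) = A + 2 * l * C + l\<^sup>2 * B"
      unfolding A_def B_def C_def using f2 g2 fg by simp
    finally show ?thesis .
  qed
  have nn: "0 \<le> A" "0 \<le> B" unfolding A_def B_def by simp_all
  have "C\<^sup>2 \<le> A * B"
  proof (cases "B = 0")
    case True
    have "C = 0"
    proof (rule ccontr)
      assume "C \<noteq> 0"
      then show False using quad[of "- (A + 1) / (2 * C)"] True by (simp add: field_simps)
    qed
    then show ?thesis using nn by simp
  next
    case False
    then have "B > 0" using nn by simp
    then show ?thesis using quad[of "- C / B"] by (simp add: field_simps power2_eq_square)
  qed
  then have "\<bar>C\<bar> \<le> sqrt (A * B)" by (rule real_le_rsqrt[of "\<bar>C\<bar>", unfolded power2_abs])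
  then show "(LINT x|M. f x * g x) \<le> sqrt (LINT x|M. (f x)\<^sup>2) * sqrt (LINT x|M. (g x)\<^sup>2)"
    unfolding A_def B_def C_def by (simp add: real_sqrt_mult)
qed

lemma L2_on_Cauchy_Schwarz:
  assumes f: "set_borel_measurable lebesgue S f" and g: "set_borel_measurable lebesgue S g"
    and f2: "L2_on S f" and g2: "L2_on S g"
  shows "set_integrable lebesgue S (\<lambda>t. f t * g t)"
    and "(LINT t:S|lebesgue. f t * g t) \<le> L2_norm_on S f * L2_norm_on S g"
proof -
  have sq: "(indicator S t *\<^sub>R h t)\<^sup>2 = indicator S t *\<^sub>R (h t)\<^sup>2" for h :: "real \<Rightarrow> real" and t
    by (simp add: indicator_def)
  have pr: "(indicator S t *\<^sub>R f t) * (indicator S t *\<^sub>R g t) = indicator S t *\<^sub>R (f t * g t)" for t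
    by (simp add: indicator_def)
  note CS = integral_Cauchy_Schwarz[OF f[unfolded set_borel_measurable_def] g[unfolded set_borel_measurable_def],
      unfolded sq pr, OF f2[unfolded L2_on_def set_integrable_def] g2[unfolded L2_on_def set_integrable_def]]
  show "set_integrable lebesgue S (\<lambda>t. f t * g t)"
    using CS(1) unfolding set_integrable_def .
  show "(LINT t:S|lebesgue. f t * g t) \<le> L2_norm_on S f * L2_norm_on S g"
    using CS(2) unfolding L2_norm_on_def set_lebesgue_integral_def .
qed

section \<open>Spectral integrals\<close>

definition dyadic_set :: "(real \<Rightarrow> real) \<Rightarrow> nat \<Rightarrow> nat \<Rightarrow> real set" where
  "dyadic_set g n i = {z. real i / 2 ^ n \<le> g z \<and> g z < (real i + 1) / 2 ^ n}"

text \<open>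
  The simple function whose spectral integral is the \<open>n\<close>-th approximation in the definition of
  \<open>spectral_int\<close>. It is zero, not \<open>2 ^ n\<close>, where \<open>g\<close> is at least \<open>2 ^ n\<close>.
\<close>

definition dyadic_step :: "(real \<Rightarrow> real) \<Rightarrow> nat \<Rightarrow> real \<Rightarrow> real" where
  "dyadic_step g n z = (\<Sum>i<4 ^ n. (real i / 2 ^ n) * indicator (dyadic_set g n i) z)"

lemma dyadic_set_borel [measurable]:
  assumes [measurable]: "g \<in> borel_measurable borel"
  shows "dyadic_set g n i \<in> sets borel"
  unfolding dyadic_set_def by measurable

lemma dyadic_step_borel [measurable]:
  assumes [measurable]: "g \<in> borel_measurable borel"
  shows "dyadic_step g n \<in> borel_measurable borel"
  unfolding dyadic_step_def[abs_def] by measurable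

lemma dyadic_step_eq:
  assumes g: "0 \<le> g z"
  shows "dyadic_step g n z = (if g z < 2 ^ n then of_int \<lfloor>2 ^ n * g z\<rfloor> / 2 ^ n else 0)"
proof -
  define m where "m = nat \<lfloor>2 ^ n * g z\<rfloor>"
  have m: "real m = of_int \<lfloor>2 ^ n * g z\<rfloor>" using g unfolding m_def by simp
  have iff: "z \<in> dyadic_set g n i \<longleftrightarrow> i = m" for i
  proof -
    have "z \<in> dyadic_set g n i \<longleftrightarrow> real i \<le> 2 ^ n * g z \<and> 2 ^ n * g z < real i + 1"
      unfolding dyadic_set_def by (simp add: field_simps)
    also have "\<dots> \<longleftrightarrow> \<lfloor>2 ^ n * g z\<rfloor> = int i" by (simp add: floor_eq_iff)
    also have "\<dots> \<longleftrightarrow> i = m" using g unfolding m_def by auto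
    finally show ?thesis .
  qed
  have "dyadic_step g n z = (\<Sum>i<4 ^ n. if i = m then real m / 2 ^ n else 0)"
    unfolding dyadic_step_def by (rule sum.cong) (auto simp: iff indicator_def)
  also have "\<dots> = (if m < 4 ^ n then real m / 2 ^ n else 0)" by simp
  also have "m < 4 ^ n \<longleftrightarrow> g z < 2 ^ n"
  proof -
    have "m < 4 ^ n \<longleftrightarrow> \<lfloor>2 ^ n * g z\<rfloor> < 4 ^ n"
      unfolding m_def using g by (metis (no_types, opaque_lifting) mult_nonneg_nonneg nat_less_iff of_nat_numeral of_nat_power zero_le_floor zero_le_numeral zero_le_power)
    also have "\<dots> \<longleftrightarrow> 2 ^ n * g z < 2 ^ n * 2 ^ n"
      by (simp add: floor_less_iff power_mult_distrib[symmetric])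
    finally show ?thesis by simp
  qed
  finally show ?thesis by (simp add: m)
qed

lemma dyadic_step_nonneg: "0 \<le> g z \<Longrightarrow> 0 \<le> dyadic_step g n z"
  by (simp add: dyadic_step_eq)

lemma dyadic_step_le: "0 \<le> g z \<Longrightarrow> dyadic_step g n z \<le> g z"
  by (simp add: dyadic_step_eq field_simps)

lemma dyadic_step_mono:
  assumes "0 \<le> g z" "m \<le> n"
  shows "dyadic_step g m z \<le> dyadic_step g n z"
proof -
  have "dyadic_step g k z \<le> dyadic_step g (Suc k) z" for k
  proof (cases "g z < 2 ^ k")
    case True
    then have "g z < 2 ^ Suc k" using assms by auto
    moreover have "2 * \<lfloor>2 ^ k * g z\<rfloor> \<le> \<lfloor>2 ^ Suc k * g z\<rfloor>" by (simp add: le_floor_iff mult.assoc)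
    then have "2 * real_of_int \<lfloor>2 ^ k * g z\<rfloor> \<le> real_of_int \<lfloor>2 ^ Suc k * g z\<rfloor>" by linarith
    ultimately show ?thesis using True assms(1) by (simp add: dyadic_step_eq field_simps)
  qed (use dyadic_step_nonneg[of g z "Suc k"] assms(1) in \<open>simp add: dyadic_step_eq\<close>)
  then show ?thesis using assms(2) by (rule lift_Suc_mono_le)
qed

lemma dyadic_step_tendsto:
  assumes g: "0 \<le> g z"
  shows "(\<lambda>n. dyadic_step g n z) \<longlonglongrightarrow> g z"
proof (rule tendsto_sandwich)
  obtain N where N: "g z < 2 ^ N" using real_arch_pow[of 2 "g z"] by auto
  show "\<forall>\<^sub>F n in sequentially. g z - (1 / 2) ^ n \<le> dyadic_step g n z"
    using eventually_ge_at_top[of N]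
  proof eventually_elim
    case (elim n)
    have "g z < 2 ^ n" using N elim by (meson less_le_trans one_le_numeral power_increasing)
    moreover have "2 ^ n * g z - 1 \<le> real_of_int \<lfloor>2 ^ n * g z\<rfloor>" by linarith
    then have "(2 ^ n * g z - 1) / 2 ^ n \<le> of_int \<lfloor>2 ^ n * g z\<rfloor> / 2 ^ n" by (rule divide_right_mono) simp
    ultimately show ?case using g by (simp add: dyadic_step_eq diff_divide_distrib power_one_over)
  qed
  show "\<forall>\<^sub>F n in sequentially. dyadic_step g n z \<le> g z" using g by (simp add: dyadic_step_le)
  have "(\<lambda>n. g z - (1 / 2) ^ n) \<longlonglongrightarrow> g z - 0" by (intro tendsto_intros) auto
  then show "(\<lambda>n. g z - (1 / 2) ^ n) \<longlonglongrightarrow> g z" by simp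
qed simp

context
  fixes P :: "real set \<Rightarrow> 'h::{real_inner,complete_space} \<Rightarrow> 'h"
  assumes P: "projection_measure P"
begin

lemma pm_bounded_linear: "B \<in> sets borel \<Longrightarrow> bounded_linear (P B)"
  and pm_idem: "B \<in> sets borel \<Longrightarrow> P B (P B x) = P B x"
  and pm_sym: "B \<in> sets borel \<Longrightarrow> inner (P B x) y = inner x (P B y)"
  and pm_UNIV: "P UNIV x = x"
  and pm_sums: "range A \<subseteq> sets borel \<Longrightarrow> disjoint_family A \<Longrightarrow> (\<lambda>i::nat. P (A i) x) sums P (\<Union>i. A i) x"
  using P unfolding projection_measure_def by simp_all

lemma pm_add: "B \<in> sets borel \<Longrightarrow> P B (x + y) = P B x + P B y"
  and pm_scaleR: "B \<in> sets borel \<Longrightarrow> P B (c *\<^sub>R x) = c *\<^sub>R P B x"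
  using pm_bounded_linear[THEN bounded_linear.linear] by (auto simp: linear_add linear_scale)

lemma pm_empty: "P {} x = 0"
proof -
  have "(\<lambda>i::nat. P {} x) sums P {} x"
    using pm_sums[of "\<lambda>_. {}" x] by (simp add: disjoint_family_on_def)
  then have "(\<lambda>i::nat. P {} x) \<longlonglongrightarrow> 0" using summable_LIMSEQ_zero sums_summable by blast
  then show ?thesis by (simp add: LIMSEQ_const_iff)
qed

lemma pm_Un:
  assumes "A \<in> sets borel" "B \<in> sets borel" "A \<inter> B = {}"
  shows "P (A \<union> B) x = P A x + P B x"
proof -
  have "(\<lambda>i. P (binaryset A B i) x) sums P (\<Union>i. binaryset A B i) x"
    using assms by (intro pm_sums) (auto simp: range_binaryset_eq disjoint_family_on_def binaryset_def)
  moreover have "(\<lambda>i. P (binaryset A B i) x) sums (P A x + P B x)"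
    by (rule binaryset_sums) (rule pm_empty)
  ultimately show ?thesis by (metis UN_binaryset_eq sums_unique2)
qed

text \<open>
  That \<open>P (A \<union> B) = P A + P B\<close> is idempotent means that \<open>P A\<close> and \<open>P B\<close> anticommute. Using
  anticommutation once more at \<open>P A x\<close> shows that they also commute, so that both products vanish.
\<close>

lemma pm_disjoint:
  assumes A: "A \<in> sets borel" and B: "B \<in> sets borel" and "A \<inter> B = {}"
  shows "P A (P B x) = 0"
proof -
  have anti: "P A (P B y) + P B (P A y) = 0" for y
  proof -
    have "P (A \<union> B) (P (A \<union> B) y) = P (A \<union> B) y" using A B by (intro pm_idem) auto
    then have "P A (P A y + P B y) + P B (P A y + P B y) = P A y + P B y"
      by (simp add: pm_Un[OF assms])
    then show ?thesis by (simp add: pm_add A B pm_idem algebra_simps)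
  qed
  have "P A (P A (P B x) + P B (P A x)) = 0"
    unfolding anti[of x] using pm_bounded_linear[OF A, THEN bounded_linear.linear] by (rule linear_0)
  then have 1: "P A (P B x) + P A (P B (P A x)) = 0" by (simp add: pm_add A pm_idem)
  have 2: "P A (P B (P A x)) + P B (P A x) = 0" using anti[of "P A x"] by (simp add: pm_idem A)
  have "P A (P B x) = P B (P A x)" using 1 2 by (metis add.commute add_left_cancel)
  then have "2 *\<^sub>R P A (P B x) = 0" using anti[of x] by (simp add: scaleR_2)
  then show ?thesis by simp
qed

lemma pm_Int:
  assumes A: "A \<in> sets borel" and B: "B \<in> sets borel"
  shows "P A (P B x) = P (A \<inter> B) x"
proof -
  have a: "P A y = P (A \<inter> B) y + P (A - B) y" for y
    using pm_Un[of "A \<inter> B" "A - B" y] A B by (auto simp: Int_Diff_Un)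
  have b: "P B y = P (A \<inter> B) y + P (B - A) y" for y
  proof -
    have "B = (A \<inter> B) \<union> (B - A)" by blast
    then show ?thesis using pm_Un[of "A \<inter> B" "B - A" y] A B by auto
  qed
  have disj: "A \<inter> B \<inter> (B - A) = {}" "(A - B) \<inter> (A \<inter> B) = {}" "(A - B) \<inter> (B - A) = {}" by auto
  have "P A (P B x) = P (A \<inter> B) (P (A \<inter> B) x) + P (A \<inter> B) (P (B - A) x)
      + (P (A - B) (P (A \<inter> B) x) + P (A - B) (P (B - A) x))"
    unfolding a[of "P B x"] unfolding b[of x] using A B by (simp add: pm_add)
  also have "\<dots> = P (A \<inter> B) x"
    using A B by (simp add: pm_idem pm_disjoint[of "A \<inter> B" "B - A"] pm_disjoint[of "A - B" "A \<inter> B"]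
        pm_disjoint[of "A - B" "B - A"] disj)
  finally show ?thesis .
qed

lemma inner_pm_Int:
  assumes "A \<in> sets borel" "B \<in> sets borel"
  shows "inner (P A x) (P B x) = inner (P (A \<inter> B) x) x"
  using assms by (simp add: pm_sym pm_Int)

lemma sets_scalar_measure [measurable_cong, simp]: "sets (scalar_measure P x) = sets borel"
  and space_scalar_measure [simp]: "space (scalar_measure P x) = UNIV"
  unfolding scalar_measure_def using sets.sigma_sets_eq[of borel] by (simp_all add: sets_measure_of space_measure_of)

lemma emeasure_scalar_measure:
  assumes B: "B \<in> sets borel"
  shows "emeasure (scalar_measure P x) B = ennreal (inner (P B x) x)"
  unfolding scalar_measure_def
proof (rule emeasure_measure_of_sigma[OF _ _ _ B])
  show "sigma_algebra UNIV (sets (borel::real measure))"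
    using sets.sigma_algebra_axioms[of "borel::real measure"] by simp
  show "positive (sets borel) (\<lambda>B. ennreal (inner (P B x) x))"
    by (simp add: positive_def pm_empty)
  show "countably_additive (sets borel) (\<lambda>B. ennreal (inner (P B x) x))"
  proof (rule countably_additiveI)
    fix A :: "nat \<Rightarrow> real set"
    assume A: "range A \<subseteq> sets borel" "disjoint_family A"
    have "(\<lambda>i. inner (P (A i) x) x) sums inner (P (\<Union>i. A i) x) x"
      using bounded_linear.sums[OF bounded_linear_inner_left pm_sums[OF A]] .
    moreover have "0 \<le> inner (P (A i) x) x" for i
      using inner_pm_Int[of "A i" "A i" x] A(1) by (metis Int_absorb inner_ge_zero range_subsetD)
    ultimately show "(\<Sum>i. ennreal (inner (P (A i) x) x)) = ennreal (inner (P (\<Union>i. A i) x) x)"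
      by (rule suminf_ennreal_eq[rotated])
  qed
qed

lemma measure_scalar_measure:
  assumes B: "B \<in> sets borel"
  shows "measure (scalar_measure P x) B = inner (P B x) x"
proof -
  have "0 \<le> inner (P B x) x" using inner_pm_Int[OF B B, of x] by (metis Int_absorb inner_ge_zero)
  then show ?thesis unfolding measure_def emeasure_scalar_measure[OF B] by simp
qed

lemma finite_scalar_measure: "finite_measure (scalar_measure P x)"
  by (rule finite_measureI) (simp add: emeasure_scalar_measure)

definition spectral_approx :: "(real \<Rightarrow> real) \<Rightarrow> nat \<Rightarrow> 'h \<Rightarrow> 'h" where
  "spectral_approx g n x = (\<Sum>i<4 ^ n. (real i / 2 ^ n) *\<^sub>R P (dyadic_set g n i) x)"

lemma spectral_approx_bounded_linear:
  assumes "g \<in> borel_measurable borel"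
  shows "bounded_linear (spectral_approx g n)"
  unfolding spectral_approx_def[abs_def]
  using assms by (intro bounded_linear_sum bounded_linear_const_scaleR pm_bounded_linear dyadic_set_borel)

text \<open>
  The isometry property of the spectral integral on simple functions, in polarized form. The
  orthogonality of \<open>P\<close> on disjoint sets turns the double sum of inner products into the integral of a
  product of step functions.
\<close>

lemma inner_spectral_approx:
  assumes g [measurable]: "g \<in> borel_measurable borel"
  shows "integrable (scalar_measure P x) (\<lambda>z. dyadic_step g m z * dyadic_step g n z)" (is ?int)
    and "inner (spectral_approx g m x) (spectral_approx g n x) =
      (LINT z|scalar_measure P x. dyadic_step g m z * dyadic_step g n z)" (is ?eq)
proof -
  interpret finite_measure "scalar_measure P x" by (rule finite_scalar_measure)
  let ?D = "dyadic_set g"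
  have eq: "dyadic_step g m z * dyadic_step g n z =
      (\<Sum>i<4^m. \<Sum>l<4^n. (real i / 2^m * (real l / 2^n)) * indicator (?D m i \<inter> ?D n l) z)" for z
    unfolding dyadic_step_def by (simp add: sum_product indicator_inter_arith mult_ac)
  have int: "integrable (scalar_measure P x) (\<lambda>z. c * indicator (?D m i \<inter> ?D n l) z :: real)" for c i l
    by (intro integrable_mult_right integrable_real_indicator) (auto simp: emeasure_finite less_top[symmetric])
  show ?int unfolding eq by (intro Bochner_Integration.integrable_sum int)
  have "inner (spectral_approx g m x) (spectral_approx g n x) =
     (\<Sum>i<4^m. \<Sum>l<4^n. (real i / 2^m * (real l / 2^n)) * inner (P (?D m i) x) (P (?D n l) x))"
    unfolding spectral_approx_def inner_sum_left by (simp add: inner_sum_right sum_distrib_left mult_ac)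
  also have "\<dots> = (\<Sum>i<4^m. \<Sum>l<4^n. (real i / 2^m * (real l / 2^n)) * measure (scalar_measure P x) (?D m i \<inter> ?D n l))"
    by (simp add: inner_pm_Int measure_scalar_measure)
  also have "\<dots> = (\<Sum>i<4^m. LINT z|scalar_measure P x.
      (\<Sum>l<4^n. (real i / 2^m * (real l / 2^n)) * indicator (?D m i \<inter> ?D n l) z))"
    by (simp only: Bochner_Integration.integral_sum[OF int]) simp
  also have "\<dots> = (LINT z|scalar_measure P x. dyadic_step g m z * dyadic_step g n z)"
    unfolding eq by (intro Bochner_Integration.integral_sum[symmetric] Bochner_Integration.integrable_sum int)
  finally show ?eq .
qed

context
  fixes g :: "real \<Rightarrow> real"
  assumes g [measurable]: "g \<in> borel_measurable borel" and g0: "\<And>z. 0 \<le> g z"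
begin

lemma norm_spectral_approx:
  "ennreal ((norm (spectral_approx g n x))\<^sup>2) = (\<integral>\<^sup>+ z. ennreal ((dyadic_step g n z)\<^sup>2) \<partial>scalar_measure P x)"
  using inner_spectral_approx(1)[OF g, where x=x and m=n and n=n] inner_spectral_approx(2)[OF g, where x=x and m=n and n=n]
  by (simp add: power2_norm_eq_inner power2_eq_square[of "dyadic_step g n _"] nn_integral_eq_integral)

lemma SUP_norm_spectral_approx:
  "(SUP n. ennreal ((norm (spectral_approx g n x))\<^sup>2)) = (\<integral>\<^sup>+ z. ennreal ((g z)\<^sup>2) \<partial>scalar_measure P x)"
proof -
  have inc: "incseq (\<lambda>n. ennreal ((dyadic_step g n z)\<^sup>2))" for z
    by (intro monoI ennreal_leI power_mono dyadic_step_mono dyadic_step_nonneg g0)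
  have "(SUP n. ennreal ((dyadic_step g n z)\<^sup>2)) = ennreal ((g z)\<^sup>2)" for z
    by (rule LIMSEQ_unique[OF LIMSEQ_SUP[OF inc]])
      (intro tendsto_ennrealI tendsto_power dyadic_step_tendsto g0)
  then have "(\<integral>\<^sup>+ z. ennreal ((g z)\<^sup>2) \<partial>scalar_measure P x) =
      (\<integral>\<^sup>+ z. (SUP n. ennreal ((dyadic_step g n z)\<^sup>2)) \<partial>scalar_measure P x)" by simp
  also have "\<dots> = (SUP n. (\<integral>\<^sup>+ z. ennreal ((dyadic_step g n z)\<^sup>2) \<partial>scalar_measure P x))"
  proof (rule nn_integral_monotone_convergence_SUP)
    show "incseq (\<lambda>n z. ennreal ((dyadic_step g n z)\<^sup>2))" using inc by (auto simp: mono_def le_fun_def)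
  qed measurable
  finally show ?thesis by (simp add: norm_spectral_approx)
qed

lemma norm_spectral_approx_mono: "m \<le> n \<Longrightarrow> norm (spectral_approx g m x) \<le> norm (spectral_approx g n x)"
proof -
  assume "m \<le> n"
  then have "ennreal ((norm (spectral_approx g m x))\<^sup>2) \<le> ennreal ((norm (spectral_approx g n x))\<^sup>2)"
    unfolding norm_spectral_approx
    by (intro nn_integral_mono ennreal_leI power_mono dyadic_step_mono dyadic_step_nonneg g0)
  then show ?thesis by (simp add: abs_le_square_iff[symmetric])
qed

text \<open>
  By monotone convergence, membership in the domain becomes a uniform bound for bounded operators. In
  this form it visibly passes to multiples and differences.
\<close>

lemma spectral_dom_iff_bounded:
  "x \<in> spectral_dom P g \<longleftrightarrow> (\<exists>C. \<forall>n. norm (spectral_approx g n x) \<le> C)"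
proof
  assume "x \<in> spectral_dom P g"
  then have fin: "(SUP n. ennreal ((norm (spectral_approx g n x))\<^sup>2)) < \<infinity>"
    unfolding SUP_norm_spectral_approx spectral_dom_def by simp
  then obtain c where c: "c \<ge> 0" "(SUP n. ennreal ((norm (spectral_approx g n x))\<^sup>2)) = ennreal c"
    by (metis infinity_ennreal_def less_top_ennreal)
  have "norm (spectral_approx g n x) \<le> sqrt c" for n
  proof -
    have "ennreal ((norm (spectral_approx g n x))\<^sup>2) \<le> ennreal c" unfolding c(2)[symmetric] by (rule SUP_upper) simp
    then show ?thesis using c(1) by (simp add: real_le_rsqrt)
  qed
  then show "\<exists>C. \<forall>n. norm (spectral_approx g n x) \<le> C" by blast
next
  assume "\<exists>C. \<forall>n. norm (spectral_approx g n x) \<le> C"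
  then obtain C where C: "\<And>n. norm (spectral_approx g n x) \<le> C" by blast
  have "(SUP n. ennreal ((norm (spectral_approx g n x))\<^sup>2)) \<le> ennreal (C\<^sup>2)"
    by (intro SUP_least ennreal_leI power_mono C) simp
  also have "\<dots> < \<infinity>" by simp
  finally show "x \<in> spectral_dom P g" unfolding SUP_norm_spectral_approx spectral_dom_def by simp
qed

text \<open>
  The squared norms \<open>q n\<close> of the approximations are increasing and bounded on the domain. Because the
  step functions are nonnegative and increasing, \<open>\<parallel>x\<^sub>n - x\<^sub>m\<parallel>\<^sup>2 \<le> q n - q m\<close> for \<open>m \<le> n\<close>, where \<open>x\<^sub>n\<close>
  is the \<open>n\<close>-th approximation. Hence the approximations form a Cauchy sequence, so the limit in
  the definition of \<open>spectral_int\<close> exists.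
\<close>

lemma spectral_approx_tendsto:
  assumes x: "x \<in> spectral_dom P g"
  shows "(\<lambda>n. spectral_approx g n x) \<longlonglongrightarrow> spectral_int P g x"
proof -
  obtain C where C: "\<And>n. norm (spectral_approx g n x) \<le> C" using x spectral_dom_iff_bounded by blast
  define q where "q n = (norm (spectral_approx g n x))\<^sup>2" for n
  have "incseq q" unfolding q_def by (intro monoI power_mono norm_spectral_approx_mono) auto
  moreover have "\<And>n. \<bar>q n\<bar> \<le> C\<^sup>2" unfolding q_def by (simp add: power_mono C)
  ultimately have "convergent q" by (metis Bseq_mono_convergent BseqI' mono_def real_norm_def)
  then have "Cauchy q" by (rule convergent_Cauchy)
  have dist: "(norm (spectral_approx g n x - spectral_approx g m x))\<^sup>2 \<le> q n - q m" if "m \<le> n" for m n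
  proof -
    have "q m = (LINT z|scalar_measure P x. dyadic_step g m z * dyadic_step g m z)"
      unfolding q_def power2_norm_eq_inner by (rule inner_spectral_approx(2)[OF g])
    also have "\<dots> \<le> (LINT z|scalar_measure P x. dyadic_step g n z * dyadic_step g m z)"
      by (intro integral_mono inner_spectral_approx(1)[OF g] mult_right_mono dyadic_step_mono
          dyadic_step_nonneg g0 that)
    also have "\<dots> = inner (spectral_approx g n x) (spectral_approx g m x)"
      by (rule inner_spectral_approx(2)[OF g, symmetric])
    finally show ?thesis unfolding q_def
      by (simp add: power2_norm_eq_inner inner_diff_left inner_diff_right inner_commute)
  qed
  have "Cauchy (\<lambda>n. spectral_approx g n x)"
  proof (rule CauchyI')
    fix e :: real assume e: "e > 0"
    then obtain M where M: "\<And>m n. m \<ge> M \<Longrightarrow> n \<ge> M \<Longrightarrow> norm (q m - q n) < e\<^sup>2"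
      using CauchyD[OF \<open>Cauchy q\<close>, of "e\<^sup>2"] by auto
    show "\<exists>M. \<forall>m\<ge>M. \<forall>n>m. dist (spectral_approx g m x) (spectral_approx g n x) < e"
    proof (intro exI[of _ M] allI impI)
      fix m n assume "M \<le> m" "m < n"
      then have "(norm (spectral_approx g n x - spectral_approx g m x))\<^sup>2 < e\<^sup>2"
        using dist[of m n] M[of n m] by auto
      then have "norm (spectral_approx g n x - spectral_approx g m x) < e"
        using e power_less_imp_less_base less_imp_le by blast
      then show "dist (spectral_approx g m x) (spectral_approx g n x) < e"
        by (simp add: dist_norm norm_minus_commute)
    qed
  qed
  then have "convergent (\<lambda>n. spectral_approx g n x)" by (rule Cauchy_convergent)
  then show ?thesis
    unfolding spectral_int_def spectral_approx_def dyadic_set_def by (simp add: convergent_LIMSEQ_iff)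
qed

lemma norm_spectral_approx_le:
  assumes "x \<in> spectral_dom P g"
  shows "norm (spectral_approx g n x) \<le> norm (spectral_int P g x)"
  by (rule incseq_le[OF _ tendsto_norm[OF spectral_approx_tendsto[OF assms]]])
    (simp add: monoI norm_spectral_approx_mono)

lemma norm_spectral_int:
  assumes "x \<in> spectral_dom P g"
  shows "ennreal ((norm (spectral_int P g x))\<^sup>2) = (\<integral>\<^sup>+ z. ennreal ((g z)\<^sup>2) \<partial>scalar_measure P x)"
proof -
  have "incseq (\<lambda>n. ennreal ((norm (spectral_approx g n x))\<^sup>2))"
    by (intro monoI ennreal_leI power_mono norm_spectral_approx_mono) auto
  moreover have "(\<lambda>n. ennreal ((norm (spectral_approx g n x))\<^sup>2)) \<longlonglongrightarrow> ennreal ((norm (spectral_int P g x))\<^sup>2)"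
    by (intro tendsto_ennrealI tendsto_power tendsto_norm spectral_approx_tendsto assms)
  ultimately show ?thesis unfolding SUP_norm_spectral_approx[symmetric]
    using LIMSEQ_SUP LIMSEQ_unique by blast
qed

lemma spectral_dom_scaleR:
  assumes "x \<in> spectral_dom P g"
  shows "c *\<^sub>R x \<in> spectral_dom P g" 
    and "spectral_int P g (c *\<^sub>R x) = c *\<^sub>R spectral_int P g x"
proof -
  have eq: "spectral_approx g n (c *\<^sub>R x) = c *\<^sub>R spectral_approx g n x" for n
    using spectral_approx_bounded_linear[OF g, THEN bounded_linear.linear] by (rule linear_scale)
  obtain C where "\<And>n. norm (spectral_approx g n x) \<le> C" using assms spectral_dom_iff_bounded by blast
  then have "norm (spectral_approx g n (c *\<^sub>R x)) \<le> \<bar>c\<bar> * C" for n by (simp add: eq mult_left_mono)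
  then show dom: "c *\<^sub>R x \<in> spectral_dom P g" using spectral_dom_iff_bounded by blast
  have "(\<lambda>n. c *\<^sub>R spectral_approx g n x) \<longlonglongrightarrow> c *\<^sub>R spectral_int P g x"
    by (intro tendsto_intros spectral_approx_tendsto assms)
  then show "spectral_int P g (c *\<^sub>R x) = c *\<^sub>R spectral_int P g x"
    using LIMSEQ_unique spectral_approx_tendsto[OF dom] unfolding eq by blast
qed

text \<open>
  Norm bounds for differences pass from the bounded operators \<open>spectral_approx g n\<close> to the unbounded
  operator \<open>spectral_int P g\<close>.
\<close>

lemma norm_spectral_int_diff_le:
  assumes "x \<in> spectral_dom P g" "y \<in> spectral_dom P g"
    and "\<And>n. norm (spectral_approx g n x - spectral_approx g n y) \<le> M"
  shows "norm (spectral_int P g (x - y)) \<le> M"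
proof -
  have eq: "spectral_approx g n (x - y) = spectral_approx g n x - spectral_approx g n y" for n
    using spectral_approx_bounded_linear[OF g, THEN bounded_linear.linear] by (rule linear_diff)
  have "x - y \<in> spectral_dom P g" using assms(3) unfolding spectral_dom_iff_bounded eq by blast
  from tendsto_norm[OF spectral_approx_tendsto[OF this]] show ?thesis
    by (rule LIMSEQ_le_const2) (use assms(3) eq in auto)
qed

end

text \<open>
  Inequalities between the operators \<open>\<integral> g dP\<close> and \<open>\<integral> h dP\<close> follow from pointwise inequalities between
  \<open>g\<close> and \<open>h\<close>, integrated against the scalar measure of \<open>x\<close>. This is how the interpolation
  inequality between the spaces \<open>V P \<alpha>\<close> enters.
\<close>

lemma norm_spectral_int_interpolation:
  assumes g [measurable]: "g \<in> borel_measurable borel" and g0: "\<And>z. 0 \<le> g z"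
    and h [measurable]: "h \<in> borel_measurable borel" and h0: "\<And>z. 0 \<le> h z"
    and x: "x \<in> spectral_dom P h" and ab: "0 \<le> a" "0 \<le> b"
    and le: "\<And>z. (g z)\<^sup>2 \<le> a + b * (h z)\<^sup>2"
  shows "x \<in> spectral_dom P g"
    and "(norm (spectral_int P g x))\<^sup>2 \<le> a * (norm x)\<^sup>2 + b * (norm (spectral_int P h x))\<^sup>2"
proof -
  have "(\<integral>\<^sup>+ z. ennreal ((g z)\<^sup>2) \<partial>scalar_measure P x)
      \<le> (\<integral>\<^sup>+ z. ennreal a + ennreal b * ennreal ((h z)\<^sup>2) \<partial>scalar_measure P x)"
  proof (rule nn_integral_mono)
    show "ennreal ((g z)\<^sup>2) \<le> ennreal a + ennreal b * ennreal ((h z)\<^sup>2)" for z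
      using ab le[of z] by (simp add: ennreal_mult[symmetric] ennreal_plus[symmetric] ennreal_leI del: ennreal_plus)
  qed
  also have "\<dots> = ennreal a * emeasure (scalar_measure P x) UNIV + ennreal b * (\<integral>\<^sup>+ z. ennreal ((h z)\<^sup>2) \<partial>scalar_measure P x)"
    by (simp add: nn_integral_add nn_integral_cmult)
  also have "\<dots> = ennreal a * ennreal ((norm x)\<^sup>2) + ennreal b * ennreal ((norm (spectral_int P h x))\<^sup>2)"
    unfolding norm_spectral_int[OF h h0 x] by (simp add: emeasure_scalar_measure pm_UNIV power2_norm_eq_inner)
  also have "\<dots> = ennreal (a * (norm x)\<^sup>2 + b * (norm (spectral_int P h x))\<^sup>2)"
    using ab by (simp add: ennreal_mult)
  finally have *: "(\<integral>\<^sup>+ z. ennreal ((g z)\<^sup>2) \<partial>scalar_measure P x)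
      \<le> ennreal (a * (norm x)\<^sup>2 + b * (norm (spectral_int P h x))\<^sup>2)" .
  then show dom: "x \<in> spectral_dom P g"
    unfolding spectral_dom_def by (simp add: order_le_less_trans)
  show "(norm (spectral_int P g x))\<^sup>2 \<le> a * (norm x)\<^sup>2 + b * (norm (spectral_int P h x))\<^sup>2"
    using * ab unfolding norm_spectral_int[OF g g0 dom, symmetric] by (subst (asm) ennreal_le_iff) auto
qed

end

section \<open>Fractional powers and interpolation\<close>

lemma pow_fun_nonneg: "0 \<le> pow_fun s z"
  unfolding pow_fun_def by simp

lemma pow_fun_borel [measurable]: "pow_fun s \<in> borel_measurable borel"
  unfolding pow_fun_def[abs_def] by (cases "s = 0") simp_all

lemma young_coeff_nonneg: "0 \<le> a \<Longrightarrow> a < p \<Longrightarrow> 0 \<le> young_coeff p a C"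
  unfolding young_coeff_def by simp

lemma stab_coeff_nonneg: "0 \<le> a \<Longrightarrow> a < p \<Longrightarrow> 0 \<le> stab_coeff p a C"
  unfolding stab_coeff_def by simp

text \<open>
  Young's inequality for \<open>q powr \<theta> = C * (q powr \<theta> / C)\<close> with \<open>\<theta> = a / p\<close>. The conjugate exponents
  \<open>1 / (1 - \<theta>)\<close> and \<open>1 / \<theta>\<close> produce \<open>young_coeff\<close> and twice \<open>stab_coeff\<close>. For \<open>a = 0\<close> the
  claim degenerates to \<open>1 \<le> C\<close>.
\<close>

lemma powr_le_young_stab:
  assumes a: "0 \<le> a" "a < p" and C: "admissible_const a C" and q: "0 < q"
  shows "q powr (a / p) \<le> young_coeff p a C + 2 * stab_coeff p a C * q"
proof (cases "a = 0")
  case True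
  then show ?thesis using C q unfolding young_coeff_def stab_coeff_def admissible_const_def by simp
next
  case False
  have C0: "C > 0" using C unfolding admissible_const_def by simp
  define \<theta> where "\<theta> = a / p"
  have \<theta>: "0 < \<theta>" "\<theta> < 1" using a False unfolding \<theta>_def by auto
  have "q powr \<theta> = (C powr (1 / (1 - \<theta>))) powr (1 - \<theta>) * (C powr (- 1 / \<theta>) * q) powr \<theta>"
  proof -
    have "(C powr (1 / (1 - \<theta>))) powr (1 - \<theta>) = C" "(C powr (- 1 / \<theta>)) powr \<theta> = 1 / C"
      using C0 \<theta> by (simp_all only: powr_powr) (simp_all add: powr_minus_divide)
    then show ?thesis using C0 q by (simp add: powr_mult)
  qed
  also have "\<dots> \<le> (1 - \<theta>) * C powr (1 / (1 - \<theta>)) + \<theta> * (C powr (- 1 / \<theta>) * q)"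
    using C0 q \<theta> by (intro Youngs_inequality_0) auto
  finally show ?thesis
    using False a unfolding young_coeff_def stab_coeff_def \<theta>_def by (simp add: field_simps)
qed

text \<open>
  The previous inequality at \<open>q = \<kappa> z\<^sup>p\<close>. As \<open>powr\<close> is an exponential of a logarithm for every
  nonzero base, the laws of powers used here also hold for negative \<open>z\<close>.
\<close>

lemma pow_fun_le_young_stab:
  assumes a: "0 \<le> a" "a < p" and C: "admissible_const a C" and \<kappa>: "0 < \<kappa>"
  shows "\<kappa> powr (a / p) * (pow_fun (a / 2) z)\<^sup>2 \<le> young_coeff p a C + 2 * stab_coeff p a C * \<kappa> * (pow_fun (p / 2) z)\<^sup>2"
proof (cases "z = 0 \<and> a \<noteq> 0")
  case True
  then show ?thesis using a \<kappa> young_coeff_nonneg[OF a] stab_coeff_nonneg[OF a] by (simp add: pow_fun_def)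
next
  case False
  show ?thesis
  proof (cases "z = 0")
    case True
    with False have "a = 0" by simp
    then show ?thesis using C \<kappa> unfolding young_coeff_def stab_coeff_def admissible_const_def
      by (simp add: pow_fun_def)
  next
    case z: False
    have sq: "(pow_fun (s / 2) z)\<^sup>2 = z powr s" for s
      using z by (simp add: pow_fun_def power2_eq_square powr_add[symmetric])
    have "\<kappa> powr (a / p) * z powr a = (\<kappa> * z powr p) powr (a / p)"
      using \<kappa> z a by (simp add: powr_mult powr_powr)
    also have "\<dots> \<le> young_coeff p a C + 2 * stab_coeff p a C * (\<kappa> * z powr p)"
      using \<kappa> z by (intro powr_le_young_stab[OF a C]) simp
    finally show ?thesis by (simp add: sq mult.assoc)
  qed
qed

context
  fixes P :: "real set \<Rightarrow> 'h::{real_inner,complete_space} \<Rightarrow> 'h"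
  assumes P: "projection_measure P"
begin

text \<open>
  Interpolation between \<open>V P 0\<close> and \<open>V P p\<close> and Young's inequality in a single step: both are
  contained in the pointwise inequality for the spectral multipliers.
\<close>

lemma V_norm_young_stab:
  assumes a: "0 \<le> a" "a < p" and C: "admissible_const a C" and \<kappa>: "0 < \<kappa>" and v: "v \<in> V P p"
  shows "\<kappa> powr (a / p) * (V_norm P a v)\<^sup>2
      \<le> young_coeff p a C * (norm v)\<^sup>2 + 2 * stab_coeff p a C * \<kappa> * (V_norm P p v)\<^sup>2" (is ?le)
    and "v \<in> V P a" (is ?dom)
proof -
  define K where "K = \<kappa> powr (a / p)"
  have K: "K > 0" using \<kappa> unfolding K_def by simp
  have le: "(pow_fun (a / 2) z)\<^sup>2 \<le> young_coeff p a C / K + (2 * stab_coeff p a C * \<kappa> / K) * (pow_fun (p / 2) z)\<^sup>2" for z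
    using pow_fun_le_young_stab[OF a C \<kappa>, of z] K unfolding K_def[symmetric]
    by (simp add: field_simps)
  have "0 \<le> young_coeff p a C / K" "0 \<le> 2 * stab_coeff p a C * \<kappa> / K"
    using young_coeff_nonneg[OF a] stab_coeff_nonneg[OF a] K \<kappa> by simp_all
  note * = norm_spectral_int_interpolation[OF P pow_fun_borel pow_fun_nonneg pow_fun_borel pow_fun_nonneg
      v[unfolded V_def] this le]
  show ?dom using *(1) unfolding V_def .
  show ?le using *(2) K unfolding V_norm_def frac_pow_def K_def[symmetric]
    by (simp add: field_simps)
qed

lemma V_norm_scaleR:
  assumes "v \<in> V P a"
  shows "c *\<^sub>R v \<in> V P a" and "V_norm P a (c *\<^sub>R v) = \<bar>c\<bar> * V_norm P a v"
  using spectral_dom_scaleR[OF P pow_fun_borel pow_fun_nonneg assms[unfolded V_def]]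
  unfolding V_def V_norm_def frac_pow_def by simp_all

text \<open>
  The norm of \<open>V P r\<close> of an increment is bounded by the integral of the norm of the time derivative,
  although \<open>f\<close> is only absolutely continuous in the norm of the ambient space. The bounded
  operators \<open>spectral_approx\<close> preserve absolute continuity and commute with the time derivative,
  and their norms do not exceed that of the fractional power. The integrand \<open>\<phi>\<close> is a majorant because
  \<open>V_norm P r (time_deriv f t)\<close> is not known to be measurable in \<open>t\<close>.
\<close>

lemma V_norm_increment_le:
  assumes ab: "a \<le> b" and c: "c \<in> {a..b}" and ac: "absolutely_continuous_on {a..b} f"
    and der: "AE t in lborel. t \<in> {a<..<b} \<longrightarrow> f differentiable (at t) \<and>
        time_deriv f t \<in> V P r \<and> V_norm P r (time_deriv f t) \<le> \<phi> t"
    and \<phi>: "set_integrable lebesgue {a<..<b} \<phi>" and \<phi>0: "\<And>t. 0 \<le> \<phi> t"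
    and fV: "f c \<in> V P r" "f a \<in> V P r"
  shows "V_norm P r (f c - f a) \<le> (LINT t:{a<..<b}|lebesgue. \<phi> t)"
  unfolding V_norm_def frac_pow_def
proof (rule norm_spectral_int_diff_le[OF P pow_fun_borel pow_fun_nonneg fV[unfolded V_def]])
  fix n
  let ?B = "spectral_approx P (pow_fun (r / 2)) n"
  have B: "bounded_linear ?B" by (rule spectral_approx_bounded_linear[OF P pow_fun_borel])
  show "norm (?B (f c) - ?B (f a)) \<le> (LINT t:{a<..<b}|lebesgue. \<phi> t)"
  proof (rule norm_increment_le_set_integral[OF ab c _ _ \<phi> \<phi>0, of "\<lambda>t. ?B (f t)"])
    show "absolutely_continuous_on {a..b} (\<lambda>t. ?B (f t))"
      by (rule absolutely_continuous_on_bounded_linear[OF B ac])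
    show "AE t in lborel. t \<in> {a<..<b} \<longrightarrow>
       (\<exists>D. norm D \<le> \<phi> t \<and> ((\<lambda>t. ?B (f t)) has_vector_derivative D) (at t))"
      using der
    proof eventually_elim
      case (elim t)
      show ?case
      proof
        assume t: "t \<in> {a<..<b}"
        have "((\<lambda>t. ?B (f t)) has_vector_derivative ?B (time_deriv f t)) (at t)"
          using elim t by (intro bounded_linear.has_vector_derivative[OF B]) (simp add: vector_derivative_works)
        moreover have "norm (?B (time_deriv f t)) \<le> V_norm P r (time_deriv f t)"
          using elim t unfolding V_norm_def frac_pow_def V_def
          by (intro norm_spectral_approx_le[OF P pow_fun_borel pow_fun_nonneg]) auto
        ultimately show "\<exists>D. norm D \<le> \<phi> t \<and> ((\<lambda>t. ?B (f t)) has_vector_derivative D) (at t)"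
          using elim t by (meson order_trans)
      qed
    qed
  qed
qed

text \<open>
  The bound with the constant \<open>K\<close> serves twice: it makes the supremum in \<open>V_dual_norm\<close> finite, and
  it settles the vectors of norm zero, which cannot be normalized.
\<close>

lemma V_dual_le_norm:
  assumes hom: "\<And>c w. w \<in> V P r \<Longrightarrow> \<phi> (c *\<^sub>R w) = c * \<phi> w"
    and bd: "\<And>w. w \<in> V P r \<Longrightarrow> \<bar>\<phi> w\<bar> \<le> K * V_norm P r w" and w: "w \<in> V P r"
  shows "\<bar>\<phi> w\<bar> \<le> V_dual_norm P r \<phi> * V_norm P r w"
proof (cases "V_norm P r w = 0")
  case True
  then show ?thesis using bd[OF w] by simp
next
  case False
  then have pos: "V_norm P r w > 0" unfolding V_norm_def by simp
  define e where "e = (1 / V_norm P r w) *\<^sub>R w"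
  have e: "e \<in> V P r" "V_norm P r e = 1"
    unfolding e_def using V_norm_scaleR[OF w] pos by simp_all
  have "\<bar>\<phi> e\<bar> \<le> V_dual_norm P r \<phi>"
    unfolding V_dual_norm_def
  proof (rule cSUP_upper)
    show "bdd_above ((\<lambda>w. \<bar>\<phi> w\<bar>) ` {w \<in> V P r. V_norm P r w \<le> 1})"
    proof (rule bdd_aboveI2)
      fix v assume v: "v \<in> {w \<in> V P r. V_norm P r w \<le> 1}"
      have "\<bar>\<phi> v\<bar> \<le> K * V_norm P r v" using v bd by simp
      also have "\<dots> \<le> \<bar>K\<bar> * V_norm P r v" by (intro mult_right_mono) (auto simp: V_norm_def)
      also have "\<dots> \<le> \<bar>K\<bar> * 1" using v by (intro mult_left_mono) auto
      finally show "\<bar>\<phi> v\<bar> \<le> \<bar>K\<bar>" by simp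
    qed
  qed (use e in simp)
  moreover have "\<phi> e = \<phi> w / V_norm P r w" unfolding e_def using hom[OF w] by simp
  ultimately show ?thesis using pos by (simp add: field_simps)
qed

lemma lipschitz_rhs_le:
  assumes lip: "lipschitz_rhs P \<beta> \<gamma> C\<^sub>L F" and x: "x \<in> V P \<gamma>" and y: "y \<in> V P \<gamma>" and w: "w \<in> V P \<beta>"
  shows "\<bar>F x w - F y w\<bar> \<le> C\<^sub>L * V_norm P \<gamma> (x - y) * V_norm P \<beta> w"
proof -
  have dual: "F x \<in> V_dual P \<beta>" "F y \<in> V_dual P \<beta>"
    and L: "V_dual_norm P \<beta> (\<lambda>w. F x w - F y w) \<le> C\<^sub>L * V_norm P \<gamma> (x - y)"
    using lip x y unfolding lipschitz_rhs_def by blast+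
  obtain C D where CD: "\<And>w. w \<in> V P \<beta> \<Longrightarrow> \<bar>F x w\<bar> \<le> C * V_norm P \<beta> w" "\<And>w. w \<in> V P \<beta> \<Longrightarrow> \<bar>F y w\<bar> \<le> D * V_norm P \<beta> w"
    using dual unfolding V_dual_def by blast
  have "\<bar>F x w - F y w\<bar> \<le> V_dual_norm P \<beta> (\<lambda>w. F x w - F y w) * V_norm P \<beta> w"
  proof (rule V_dual_le_norm[OF _ _ w])
    show "F x (c *\<^sub>R w) - F y (c *\<^sub>R w) = c * (F x w - F y w)" if "w \<in> V P \<beta>" for c w
      using dual that unfolding V_dual_def by (simp add: right_diff_distrib)
    show "\<bar>F x w - F y w\<bar> \<le> (C + D) * V_norm P \<beta> w" if "w \<in> V P \<beta>" for w
      using CD(1)[OF that] CD(2)[OF that] by (simp add: distrib_right)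
  qed
  also have "\<dots> \<le> C\<^sub>L * V_norm P \<gamma> (x - y) * V_norm P \<beta> w"
    using L by (intro mult_right_mono) (auto simp: V_norm_def)
  finally show ?thesis .
qed

end

section \<open>Extrapolation weights\<close>

text \<open>
  The Lagrange basis is a partition of unity: as a polynomial in \<open>s\<close>, the sum has degree less than
  \<open>card A\<close> and equals 1 at each of the nodes \<open>- x l\<close>.
\<close>

lemma sum_Lagrange_basis_eq_1:
  fixes x :: "'a \<Rightarrow> real"
  assumes fin: "finite A" and ne: "A \<noteq> {}" and inj: "inj_on x A"
  shows "(\<Sum>i\<in>A. \<Prod>m\<in>A - {i}. (x m + s) / (x m - x i)) = 1"
proof -
  define q where "q = (\<Sum>i\<in>A. \<Prod>m\<in>A - {i}. smult (1 / (x m - x i)) [:x m, 1:])"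
  have pq: "poly q s = (\<Sum>i\<in>A. \<Prod>m\<in>A - {i}. (x m + s) / (x m - x i))" for s
    unfolding q_def by (simp add: poly_sum poly_prod add_divide_distrib)
  have card: "card A > 0" using fin ne by (simp add: card_gt_0_iff)
  have "degree q \<le> card A - 1"
    unfolding q_def
  proof (rule degree_sum_le[OF fin])
    fix i assume i: "i \<in> A"
    have "degree (\<Prod>m\<in>A - {i}. smult (1 / (x m - x i)) [:x m, 1:])
        \<le> (\<Sum>m\<in>A - {i}. degree (smult (1 / (x m - x i)) [:x m, 1:]))"
      using degree_prod_sum_le[of "A - {i}" "\<lambda>m. smult (1 / (x m - x i)) [:x m, 1:]"] fin
      by (simp only: o_def finite_Diff)
    also have "\<dots> \<le> (\<Sum>m\<in>A - {i}. 1)" by (intro sum_mono) (simp add: degree_pCons_eq_if)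
    also have "\<dots> = card A - 1" using i by simp
    finally show "degree (\<Prod>m\<in>A - {i}. smult (1 / (x m - x i)) [:x m, 1:]) \<le> card A - 1" .
  qed
  moreover have "card ((\<lambda>l. - x l) ` A) = card A"
    by (rule card_image) (use inj in \<open>auto simp: inj_on_def\<close>)
  moreover have "poly q y = poly 1 y" if "y \<in> (\<lambda>l. - x l) ` A" for y
  proof -
    obtain l where l: "l \<in> A" "y = - x l" using \<open>y \<in> (\<lambda>l. - x l) ` A\<close> by blast
    have "(\<Prod>m\<in>A - {i}. (x m + y) / (x m - x i)) = (if i = l then 1 else 0)" if i: "i \<in> A" for i
    proof (cases "i = l")
      case True
      have "(\<Prod>m\<in>A - {i}. (x m + y) / (x m - x i)) = (\<Prod>m\<in>A - {i}. 1)"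
        by (rule prod.cong) (use True l inj in \<open>auto simp: inj_on_def\<close>)
      then show ?thesis using True by simp
    next
      case False
      then show ?thesis using fin l by (auto intro!: prod_zero)
    qed
    then have "poly q y = (\<Sum>i\<in>A. if i = l then 1 else 0)" unfolding pq by (rule sum.cong[OF refl])
    then show ?thesis using fin l(1) by simp
  qed
  ultimately have "q = 1" using card by (intro poly_eqI_degree[of "(\<lambda>l. - x l) ` A"]) auto
  then show ?thesis using pq[of s] by simp
qed

lemma sum_lagrange_basis_eq_1:
  assumes T: "strict_mono T" and k: "1 \<le> k" "k - 1 \<le> n"
  shows "(\<Sum>i<k. lagrange_basis k T n i s) = 1"
proof -
  let ?x = "\<lambda>m. \<Sum>j=1..m. step T (n - j)"
  have x: "?x m = T n - T (n - m)" if "m \<le> n" for m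
    using that
  proof (induction m)
    case (Suc m)
    then have "Suc (n - Suc m) = n - m" by simp
    then show ?case using Suc by (simp add: step_def)
  qed simp
  have inj: "inj_on ?x {0..k - 1}"
  proof (rule inj_onI)
    fix a b assume ab: "a \<in> {0..k - 1}" "b \<in> {0..k - 1}" "?x a = ?x b"
    then have "T (n - a) = T (n - b)" using x[of a] x[of b] k by simp
    then have "n - a = n - b" using T by (simp add: strict_mono_eq)
    then show "a = b" using ab k by auto
  qed
  have "{..<k} = {0..k - 1}" using k by auto
  then show ?thesis
    unfolding lagrange_basis_def using sum_Lagrange_basis_eq_1[OF _ _ inj, of s] by simp
qed

text \<open>
  Abel summation writes the error of an extrapolation with weights of sum 1 in terms of consecutive
  differences of \<open>f0, f 0, f 1, ...\<close>.
\<close>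

lemma sum_by_parts_partition:
  fixes l f :: "nat \<Rightarrow> real"
  assumes "(\<Sum>i<k. l i) = 1"
  shows "(\<Sum>i<k. l i * f i) - f0 =
    (\<Sum>j<k. (1 - (\<Sum>i<j. l i)) * (f j - (if j = 0 then f0 else f (j - 1))))"
proof -
  have "(\<Sum>j<k. (1 - (\<Sum>i<j. l i)) * (f j - (if j = 0 then f0 else f (j - 1)))) =
    (\<Sum>i<k. l i * f i) + (1 - (\<Sum>i<k. l i)) * (if k = 0 then f0 else f (k - 1)) - f0" for k
    by (induction k) (simp_all add: algebra_simps)
  from this[of k] show ?thesis using assms by simp
qed

text \<open>
  The tails \<open>C_bar k Cs j\<close> are the right weights for the memory terms of the modified energy: since
  consecutive tails differ by \<open>Cs j\<close>, the history terms produced by the energy estimate are absorbed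
  when the time index moves by one, and only the newest term remains, with weight \<open>C_bar k Cs 0\<close>.
\<close>

lemma sum_C_bar_telescope:
  fixes Z :: "nat \<Rightarrow> real"
  assumes "1 \<le> k" 
  shows "(\<Sum>j<k. Cs j * Z (n - j)) + (\<Sum>j=1..k - 1. C_bar k Cs j * Z (n + 1 - j))
    = C_bar k Cs 0 * Z n + (\<Sum>j=1..k - 1. C_bar k Cs j * Z (n - j))"
proof -
  have shift: "(\<Sum>j=1..K. z (j - 1) - z j) = z 0 - z K" for z :: "nat \<Rightarrow> real" and K
    by (induction K) simp_all
  have main: "(\<Sum>j\<le>K. Cs j * z j) + (\<Sum>j=1..K. C_bar (Suc K) Cs j * (z (j - 1) - z j)) = C_bar (Suc K) Cs 0 * z 0"
    for z :: "nat \<Rightarrow> real" and K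
  proof (induction K)
    case 0
    then show ?case by (simp add: C_bar_def)
  next
    case (Suc K)
    have C: "C_bar (Suc (Suc K)) Cs j = C_bar (Suc K) Cs j + Cs (Suc K)" if "j \<le> Suc K" for j
      using that unfolding C_bar_def by (cases "j = Suc K") simp_all
    have "(\<Sum>j=1..Suc K. C_bar (Suc (Suc K)) Cs j * (z (j - 1) - z j))
        = (\<Sum>j=1..Suc K. C_bar (Suc K) Cs j * (z (j - 1) - z j)) + Cs (Suc K) * (\<Sum>j=1..Suc K. z (j - 1) - z j)"
      by (simp only: sum_distrib_left sum.distrib[symmetric]) (rule sum.cong, simp_all add: C algebra_simps)
    also have "(\<Sum>j=1..Suc K. C_bar (Suc K) Cs j * (z (j - 1) - z j)) = (\<Sum>j=1..K. C_bar (Suc K) Cs j * (z (j - 1) - z j))"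
      by (simp add: C_bar_def)
    also have "(\<Sum>j=1..Suc K. z (j - 1) - z j) = z 0 - z (Suc K)" by (rule shift)
    finally show ?case using Suc C[of 0] by (simp add: algebra_simps)
  qed
  have "(\<Sum>j=1..k - 1. C_bar k Cs j * Z (n + 1 - j)) = (\<Sum>j=1..k - 1. C_bar k Cs j * Z (n - (j - 1)))"
    by (rule sum.cong) (auto intro!: arg_cong[of _ _ Z])
  moreover have "{..<k} = {..k - 1}" "Suc (k - 1) = k" using assms by auto
  ultimately show ?thesis
    using main[where K = "k - 1" and z = "\<lambda>j. Z (n - j)"] by (simp add: right_diff_distrib sum_subtractf)
qed

section \<open>Estimates on one time step\<close>

text \<open>
  The square root of the bound in Young's inequality. It majorizes \<open>\<kappa> powr (a / (2 * p)) * V_norm P a v\<close>,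
  and it only involves the two norms for which measurability and square integrability in time are
  known.
\<close>

definition young_envelope ::
    "(real set \<Rightarrow> 'h::real_inner \<Rightarrow> 'h) \<Rightarrow> real \<Rightarrow> real \<Rightarrow> real \<Rightarrow> real \<Rightarrow> 'h \<Rightarrow> real" where
  "young_envelope P p a C \<kappa> v =
     sqrt (young_coeff p a C * (norm v)\<^sup>2 + 2 * stab_coeff p a C * \<kappa> * (V_norm P p v)\<^sup>2)"

lemma V_norm_le_young_envelope:
  fixes P :: "real set \<Rightarrow> 'h::{real_inner,complete_space} \<Rightarrow> 'h"
  assumes "projection_measure P" "0 \<le> a" "a < p" "admissible_const a C" "0 < \<kappa>" "v \<in> V P p"
  shows "\<kappa> powr (a / (2 * p)) * V_norm P a v \<le> young_envelope P p a C \<kappa> v"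
proof -
  have "(\<kappa> powr (a / (2 * p)))\<^sup>2 = \<kappa> powr (a / p)"
    using assms by (simp add: power2_eq_square powr_add[symmetric] field_simps)
  then have "(\<kappa> powr (a / (2 * p)) * V_norm P a v)\<^sup>2 = \<kappa> powr (a / p) * (V_norm P a v)\<^sup>2"
    by (simp add: power_mult_distrib)
  then show ?thesis
    unfolding young_envelope_def using V_norm_young_stab(1)[OF assms] by (intro real_le_rsqrt) simp
qed

lemma set_integral_sum:
  fixes f :: "'i \<Rightarrow> 'a \<Rightarrow> real"
  assumes "\<And>i. i \<in> J \<Longrightarrow> set_integrable M S (f i)"
  shows "(LINT t:S|M. (\<Sum>i\<in>J. f i t)) = (\<Sum>i\<in>J. LINT t:S|M. f i t)"
  using assms unfolding set_lebesgue_integral_def set_integrable_def scaleR_sum_right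
  by (rule Bochner_Integration.integral_sum)

lemma L2_norm_on_square: "(L2_norm_on S g)\<^sup>2 = (LINT t:S|lebesgue. (g t)\<^sup>2)"
  unfolding L2_norm_on_def set_lebesgue_integral_def
  by (intro real_sqrt_pow2 Bochner_Integration.integral_nonneg) simp

lemma L2_norm_on_nonneg: "0 \<le> L2_norm_on S g"
  unfolding L2_norm_on_def set_lebesgue_integral_def by simp

lemma young_envelope_L2:
  fixes C :: real
  assumes a: "0 \<le> a" "a < p" and \<kappa>: "0 < \<kappa>"
    and w: "L2_on S (\<lambda>t. norm (w t))" "L2_on S (\<lambda>t. V_norm P p (w t))"
  defines "h \<equiv> \<lambda>t. young_envelope P p a C \<kappa> (w t)"
  shows "L2_on S h" and "set_borel_measurable lebesgue S h"
    and "(L2_norm_on S h)\<^sup>2 = young_coeff p a C * (L2_norm_on S (\<lambda>t. norm (w t)))\<^sup>2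
      + 2 * stab_coeff p a C * \<kappa> * (L2_norm_on S (\<lambda>t. V_norm P p (w t)))\<^sup>2"
proof -
  define q where "q t = young_coeff p a C * (norm (w t))\<^sup>2 + 2 * stab_coeff p a C * \<kappa> * (V_norm P p (w t))\<^sup>2" for t
  have q0: "0 \<le> q t" for t
    unfolding q_def using young_coeff_nonneg[OF a] stab_coeff_nonneg[OF a] \<kappa> by simp
  have hq: "h t = sqrt (q t)" for t unfolding h_def young_envelope_def q_def ..
  have h2: "(h t)\<^sup>2 = q t" for t unfolding hq using q0 by simp
  note w' = w[unfolded L2_on_def]
  have q: "set_integrable lebesgue S q"
    unfolding q_def[abs_def] using w' by (intro set_integral_add(1) set_integrable_mult_right) auto
  then show "L2_on S h" unfolding L2_on_def h2 .
  have "(\<lambda>t. sqrt (indicator S t *\<^sub>R q t)) \<in> borel_measurable lebesgue"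
    using measurable_compose[OF borel_measurable_integrable[OF q[unfolded set_integrable_def]] borel_measurable_sqrt] .
  moreover have "sqrt (indicator S t *\<^sub>R q t) = indicator S t *\<^sub>R h t" for t
    unfolding hq by (simp add: indicator_def)
  ultimately show "set_borel_measurable lebesgue S h" unfolding set_borel_measurable_def by simp
  show "(L2_norm_on S h)\<^sup>2 = young_coeff p a C * (L2_norm_on S (\<lambda>t. norm (w t)))\<^sup>2
      + 2 * stab_coeff p a C * \<kappa> * (L2_norm_on S (\<lambda>t. V_norm P p (w t)))\<^sup>2"
    unfolding L2_norm_on_square h2 unfolding q_def using w'
    by (subst set_integral_add(2)) (auto intro!: set_integrable_mult_right)
qed

text \<open>
  Cauchy--Schwarz on a time step of length at most \<open>\<tau>\<close>, applied to the integral of the envelope of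
  the time derivative.
\<close>

lemma V_norm_step_increment_le:
  fixes P :: "real set \<Rightarrow> 'h::{real_inner,complete_space} \<Rightarrow> 'h"
  assumes P: "projection_measure P" and r: "0 \<le> r" "r < p" and C: "admissible_const r C" and \<kappa>: "0 < \<kappa>"
    and ab: "a \<le> b" "b - a \<le> \<tau>" and c: "c \<in> {a..b}" and ac: "absolutely_continuous_on {a..b} f"
    and der: "AE t in lborel. t \<in> {a<..<b} \<longrightarrow> f differentiable (at t) \<and> time_deriv f t \<in> V P p"
    and L2: "L2_on {a<..<b} (\<lambda>t. norm (time_deriv f t))" "L2_on {a<..<b} (\<lambda>t. V_norm P p (time_deriv f t))"
    and fV: "f c \<in> V P r" "f a \<in> V P r"
  shows "\<kappa> powr (r / (2 * p)) * V_norm P r (f c - f a)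
    \<le> sqrt \<tau> * L2_norm_on {a<..<b} (\<lambda>t. young_envelope P p r C \<kappa> (time_deriv f t))"
proof -
  define K where "K = \<kappa> powr (r / (2 * p))"
  have K: "K > 0" using \<kappa> unfolding K_def by simp
  let ?I = "{a<..<b}"
  let ?h = "\<lambda>t. young_envelope P p r C \<kappa> (time_deriv f t)"
  have h0: "0 \<le> ?h t" for t
    unfolding young_envelope_def using young_coeff_nonneg[OF r] stab_coeff_nonneg[OF r] \<kappa> by simp
  note env = young_envelope_L2[OF r \<kappa> L2]
  have one: "set_borel_measurable lebesgue ?I (\<lambda>_. 1::real)" "L2_on ?I (\<lambda>_. 1)"
    unfolding set_borel_measurable_def L2_on_def set_integrable_def
    using ab by (auto intro!: integrable_real_indicator borel_measurable_indicator)
  have "L2_norm_on ?I (\<lambda>_. 1) = sqrt (b - a)"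
    unfolding L2_norm_on_def using ab by (simp add: set_lebesgue_integral_def)
  then have L1: "L2_norm_on ?I (\<lambda>_. 1) \<le> sqrt \<tau>" using ab by simp
  note CS = L2_on_Cauchy_Schwarz[OF one(1) env(2) one(2) env(1)]
  have int: "set_integrable lebesgue ?I ?h" using CS(1) by simp
  have "V_norm P r (f c - f a) \<le> (LINT t:?I|lebesgue. ?h t / K)"
  proof (rule V_norm_increment_le[OF P ab(1) c ac _ _ _ fV])
    show "AE t in lborel. t \<in> ?I \<longrightarrow> f differentiable (at t) \<and>
        time_deriv f t \<in> V P r \<and> V_norm P r (time_deriv f t) \<le> ?h t / K"
      using der
    proof eventually_elim
      case (elim t)
      then show ?case
        using V_norm_le_young_envelope[OF P r C \<kappa>, of "time_deriv f t"]
          V_norm_young_stab(2)[OF P r C \<kappa>, of "time_deriv f t"] K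
        unfolding K_def[symmetric] by (auto simp: field_simps)
    qed
    show "set_integrable lebesgue ?I (\<lambda>t. ?h t / K)" using int by simp
  qed (use h0 K in simp)
  then have "K * V_norm P r (f c - f a) \<le> (LINT t:?I|lebesgue. 1 * ?h t)"
    using K by (simp add: field_simps)
  also have "\<dots> \<le> L2_norm_on ?I (\<lambda>_. 1) * L2_norm_on ?I ?h" by (rule CS(2))
  also have "\<dots> \<le> sqrt \<tau> * L2_norm_on ?I ?h" using L1 L2_norm_on_nonneg by (rule mult_right_mono)
  finally show ?thesis unfolding K_def .
qed

section \<open>Energy stability\<close>

theorem theorem3p4:
  fixes j :: "'x::{real_inner,complete_space} \<Rightarrow> 'h::{real_inner,complete_space}"
    and L :: "'x \<Rightarrow> ('x \<Rightarrow>\<^sub>L real)"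
    and P :: "real set \<Rightarrow> 'h \<Rightarrow> 'h"
    and \<F> :: "'h \<Rightarrow> real"
    and F :: "'h \<Rightarrow> 'h \<Rightarrow> real"
    and \<epsilon> \<beta> \<gamma> p C\<^sub>L Chat Ctilde A C\<^sub>3 C\<^sub>4 :: real
    and k :: nat
    and T Cs :: "nat \<Rightarrow> real"
    and u :: "nat \<Rightarrow> real \<Rightarrow> 'h"
  assumes "standard_triple j"
    and "linear L"
    and "\<And>x. x \<noteq> 0 \<Longrightarrow> blinfun_apply (L x) x > 0"
    and "self_adjoint_graph (realization j L)"
    and "\<And>v f. (v, f) \<in> realization j L \<Longrightarrow> inner f v \<ge> 0"
    and "spectral_measure_of (realization j L) P"
    and "\<epsilon> > 0"
    and "\<beta> \<ge> 0" and "\<gamma> \<ge> 0" and "C\<^sub>L > 0"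
    and "neg_variational_derivative P \<beta> \<gamma> \<F> F"
    and "lipschitz_rhs P \<beta> \<gamma> C\<^sub>L F"
    and "k \<ge> 1"
    and "p = (\<beta> + \<gamma>) * real k / 2"
    and "p > max \<beta> \<gamma>"
    and "time_grid k T"
    and "Cs 0 = 1"
    and "\<And>j. 1 \<le> j \<Longrightarrow> j \<le> k - 1 \<Longrightarrow> Cs j > 0"
    and "\<And>j n. 1 \<le> j \<Longrightarrow> j \<le> k - 1 \<Longrightarrow> k - 1 \<le> n \<Longrightarrow>
           L2_norm_on (interval T n) (\<lambda>t. 1 - (\<Sum>i=0..j - 1. lagrange_basis k T n i (t - T n)))
             \<le> Cs j * sqrt (max_step T)"
    and "admissible_const \<beta> Chat" and "admissible_const \<gamma> Ctilde"
    and "young_coeff p \<beta> Chat + young_coeff p \<gamma> Ctilde \<le> 2 / (C\<^sub>L * C_bar k Cs 0)"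
    and "A = C\<^sub>L * (stab_coeff p \<beta> Chat + stab_coeff p \<gamma> Ctilde) * C_bar k Cs 0"
    and "C\<^sub>3 = young_coeff p \<gamma> Ctilde / 2"
    and "C\<^sub>4 = stab_coeff p \<gamma> Ctilde"
    and "regular_in_time P \<epsilon> \<gamma> p \<F> F k T u"
    and "scheme P \<epsilon> A p F k T u"
  shows "\<forall>n\<ge>k. modified_energy P \<epsilon> \<F> C\<^sub>L C\<^sub>3 C\<^sub>4 p Cs k T u (n + 1)
                  \<le> modified_energy P \<epsilon> \<F> C\<^sub>L C\<^sub>3 C\<^sub>4 p Cs k T u n"
proof (intro allI impI)
  fix n assume n: "k \<le> n"
  have P: "projection_measure P" using assms(6) unfolding spectral_measure_of_def by simp
  have k: "1 \<le> k" by fact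
  have p: "0 \<le> \<beta>" "\<beta> < p" "0 \<le> \<gamma>" "\<gamma> < p" using assms(8,9,15) by auto
  define \<tau> where "\<tau> = max_step T"
  define \<kappa> where "\<kappa> = \<tau> ^ k"
  define cg where "cg = \<kappa> powr (\<gamma> / (2 * p))"
  define cb where "cb = \<kappa> powr (\<beta> / (2 * p))"
  define w where "w m t = time_deriv (u (m + 1)) t" for m t
  define X where "X m = (L2_norm_on (interval T m) (\<lambda>t. norm (w m t)))\<^sup>2" for m
  define Y where "Y m = (L2_norm_on (interval T m) (\<lambda>t. V_norm P p (w m t)))\<^sup>2" for m
  define hg where "hg m t = young_envelope P p \<gamma> Ctilde \<kappa> (w m t)" for m t
  define hb where "hb t = young_envelope P p \<beta> Chat \<kappa> (w n t)" for t
  define G where "G m = L2_norm_on (interval T m) (hg m)" for m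
  define B where "B = L2_norm_on (interval T n) hb"
  define S where "S j t = (\<Sum>i<j. lagrange_basis k T n i (t - T n))" for j t
  define node where "node j = u (n - j) (T (n - j))" for j
  define prev where "prev t j = (if j = 0 then u (n + 1) t else node (j - 1))" for t j

  have T: "strict_mono T" and T0: "T 0 = 0" and bdd: "bdd_above (range (step T))"
    using assms(16) unfolding time_grid_def by auto
  have step_le: "T (Suc m) - T m \<le> \<tau>" for m
    using cSUP_upper[OF UNIV_I bdd, of m] unfolding \<tau>_def max_step_def step_def .
  have step_pos: "T m < T (Suc m)" for m using T by (simp add: strict_mono_Suc_iff)
  have \<tau>: "\<tau> > 0" using step_le[of 0] step_pos[of 0] by simp
  have \<kappa>: "\<kappa> > 0" unfolding \<kappa>_def using \<tau> by simp
  have cpos: "cg > 0" "cb > 0" unfolding cg_def cb_def using \<kappa> by simp_all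
  \<comment> \<open>This is where the choice \<open>p = (\<beta> + \<gamma>) k / 2\<close> enters: it makes the two scalings combine to a single power of \<open>\<tau>\<close>.\<close>
  have cgcb: "cg * cb = \<tau>"
  proof -
    have "\<gamma> / (2 * p) + \<beta> / (2 * p) = 1 / real k"
    proof -
      have "(\<gamma> + \<beta>) * real k = 2 * p" using assms(14) by (simp add: algebra_simps)
      then have "(\<gamma> + \<beta>) / (2 * p) * real k = 1" using p by simp
      then have "(\<gamma> + \<beta>) / (2 * p) = 1 / real k" using k by (intro eq_divide_imp) auto
      then show ?thesis by (simp only: add_divide_distrib)
    qed
    then have "cg * cb = (\<tau> powr real k) powr (1 / real k)"
      unfolding cg_def cb_def \<kappa>_def powr_add[symmetric] using \<tau> by (simp add: powr_realpow)
    also have "\<dots> = \<tau>" using k \<tau> by (simp add: powr_powr)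
    finally show ?thesis .
  qed
  have T_nonneg: "0 \<le> T m" for m using T T0 by (metis strict_mono_less_eq zero_le)
  have start: "u (m + 1) (T m) = u m (T m)" for m
    using assms(27) T_nonneg[of m] unfolding scheme_def by auto

  have nodeV: "u m (T m) \<in> V P \<gamma>" for m
    using assms(26) unfolding regular_in_time_def by simp
  have regm: "absolutely_continuous_on {T m..T (m + 1)} (u (m + 1)) \<and>
        (AE t in lborel. t \<in> interval T m \<longrightarrow>
           u (m + 1) differentiable (at t) \<and> time_deriv (u (m + 1)) t \<in> V P p) \<and>
        L2_on (interval T m) (\<lambda>t. norm (time_deriv (u (m + 1)) t)) \<and>
        L2_on (interval T m) (\<lambda>t. V_norm P p (time_deriv (u (m + 1)) t))" if "1 \<le> m" for m
    using assms(26) that unfolding regular_in_time_def by simp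
  have kn: "k - 1 \<le> n" "1 \<le> n" using n k by auto
  have regn: "\<And>t. t \<in> {T n..T (n + 1)} \<Longrightarrow> u (n + 1) t \<in> V P 1 \<inter> V P p"
    "AE t in lborel. t \<in> interval T n \<longrightarrow> time_deriv (u (n + 1)) t \<in> V P 1"
    "absolutely_continuous_on {T n..T (n + 1)} (\<lambda>t. energy P \<epsilon> \<F> (u (n + 1) t))"
    "AE t in lborel. t \<in> interval T n \<longrightarrow>
           ((\<lambda>t. energy P \<epsilon> \<F> (u (n + 1) t)) has_real_derivative
              \<epsilon> * pow_dual P 1 (u (n + 1) t) (time_deriv (u (n + 1)) t)
              - F (u (n + 1) t) (time_deriv (u (n + 1)) t)) (at t)"
    using assms(26) kn(1) unfolding regular_in_time_def by blast+

  have Gsq: "(G m)\<^sup>2 = 2 * (C\<^sub>3 * X m + C\<^sub>4 * \<kappa> * Y m)" if "1 \<le> m" for m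
    using regm[OF that] young_envelope_L2(3)[OF p(3,4) \<kappa>, of "interval T m" "w m" P]
    unfolding G_def hg_def[abs_def] X_def Y_def w_def assms(24,25) by (simp add: algebra_simps)
  have Bsq: "B\<^sup>2 = young_coeff p \<beta> Chat * X n + 2 * stab_coeff p \<beta> Chat * \<kappa> * Y n"
    using regm[OF kn(2)] young_envelope_L2(3)[OF p(1,2) \<kappa>, of "interval T n" "w n" P]
    unfolding B_def hb_def[abs_def] X_def Y_def w_def by (simp add: algebra_simps)
  have hb: "L2_on (interval T n) hb" "set_borel_measurable lebesgue (interval T n) hb"
    using regm[OF kn(2)] young_envelope_L2(1,2)[OF p(1,2) \<kappa>, of "interval T n" "w n" P]
    unfolding hb_def[abs_def] w_def by simp_all

  have incr: "cg * V_norm P \<gamma> (u (m + 1) c - u m (T m)) \<le> sqrt \<tau> * G m"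
    if m: "1 \<le> m" and c: "c \<in> {T m..T (m + 1)}" "u (m + 1) c \<in> V P \<gamma>" for m c
    using V_norm_step_increment_le[OF P p(3,4) assms(21) \<kappa>, of "T m" "T (m + 1)" \<tau> c "u (m + 1)"]
      regm[OF m] c nodeV[of m] start[of m] step_le[of m] step_pos[of m]
    unfolding cg_def G_def hg_def[abs_def] w_def interval_def by simp

  \<comment> \<open>The point preceding the newest node is the running solution; at the older nodes the difference is the increment over a full time step. Only steps with index at least 1 occur, as \<open>j < k \<le> n\<close>.\<close>
  have diff: "prev t j \<in> V P \<gamma> \<and> node j \<in> V P \<gamma> \<and> cg * V_norm P \<gamma> (prev t j - node j) \<le> sqrt \<tau> * G (n - j)"
    if j: "j < k" and t: "t \<in> {T n..T (n + 1)}" for j t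
  proof (cases "j = 0")
    case True
    have "u (n + 1) t \<in> V P \<gamma>"
      using regn(1)[OF t] V_norm_young_stab(2)[OF P p(3,4) assms(21) \<kappa>] by blast
    then show ?thesis using True incr[OF kn(2) t] nodeV unfolding prev_def node_def by simp
  next
    case False
    have m: "1 \<le> n - j" "n - (j - 1) = n - j + 1" using False j n by auto
    show ?thesis
      using False incr[OF m(1), of "T (n - j + 1)"] nodeV step_pos[of "n - j"]
      unfolding prev_def node_def m(2) by simp
  qed

  have S_cont: "continuous_on R (\<lambda>t. \<bar>1 - S j t\<bar>)" for R j
    unfolding S_def lagrange_basis_def divide_inverse by (intro continuous_intros)
  have S_L2: "L2_on (interval T n) (\<lambda>t. \<bar>1 - S j t\<bar>)"
    and S_meas: "set_borel_measurable lebesgue (interval T n) (\<lambda>t. \<bar>1 - S j t\<bar>)" for j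
  proof -
    have "set_integrable lebesgue {T n..T (Suc n)} (\<lambda>t. \<bar>1 - S j t\<bar>\<^sup>2)"
      by (intro absolutely_integrable_continuous_real continuous_intros S_cont)
    then show "L2_on (interval T n) (\<lambda>t. \<bar>1 - S j t\<bar>)"
      unfolding L2_on_def interval_def by (rule set_integrable_subset) auto
    have "set_integrable lebesgue {T n..T (Suc n)} (\<lambda>t. \<bar>1 - S j t\<bar>)"
      by (intro absolutely_integrable_continuous_real S_cont)
    then have "set_integrable lebesgue (interval T n) (\<lambda>t. \<bar>1 - S j t\<bar>)"
      unfolding interval_def by (rule set_integrable_subset) auto
    then show "set_borel_measurable lebesgue (interval T n) (\<lambda>t. \<bar>1 - S j t\<bar>)"
      unfolding set_integrable_def set_borel_measurable_def by (rule borel_measurable_integrable)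
  qed
  \<comment> \<open>For \<open>j = 0\<close> the sum is empty, and the bound with \<open>Cs 0 = 1\<close> says that the time step has length at most \<open>\<tau>\<close>.\<close>
  have S_norm: "L2_norm_on (interval T n) (\<lambda>t. \<bar>1 - S j t\<bar>) \<le> Cs j * sqrt \<tau>" if "j < k" for j
  proof (cases "j = 0")
    case True
    then show ?thesis
      using step_le[of n] step_pos[of n] assms(17)
      by (simp add: L2_norm_on_def S_def interval_def set_lebesgue_integral_def)
  next
    case False
    then have "{0..j - 1} = {..<j}" by auto
    then show ?thesis
      using assms(19)[of j n] False that kn unfolding S_def \<tau>_def by (simp add: L2_norm_on_def)
  qed

  \<comment> \<open>The majorant of the time derivative of the energy: the terms of the extrapolation error, followed by the dissipation of the scheme.\<close>
  define \<psi> where "\<psi> t = (\<Sum>j<k. (C\<^sub>L * G (n - j) / sqrt \<tau>) * (\<bar>1 - S j t\<bar> * hb t))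
      - ((norm (w n t))\<^sup>2 + A * \<kappa> * (V_norm P p (w n t))\<^sup>2)" for t

  have deriv: "AE t in lborel. t \<in> interval T n \<longrightarrow>
      (\<exists>D\<le>\<psi> t. ((\<lambda>t. energy P \<epsilon> \<F> (u (n + 1) t)) has_real_derivative D) (at t))"
  proof -
    have "AE t in lborel. t \<in> interval T n \<longrightarrow>
        (\<forall>w \<in> V P 1 \<inter> V P p.
           inner (time_deriv (u (n + 1)) t) w
           + \<epsilon> * pow_dual P 1 (u (n + 1) t) w
           + A * max_step T ^ k * pow_dual P p (time_deriv (u (n + 1)) t) w
           = (\<Sum>i=0..k - 1. lagrange_basis k T n i (t - T n) * F (u (n - i) (T (n - i))) w))"
      using assms(27) kn(1) unfolding scheme_def by blast
    moreover have "AE t in lborel. t \<in> interval T n \<longrightarrow>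
           u (n + 1) differentiable (at t) \<and> time_deriv (u (n + 1)) t \<in> V P p"
      using regm[OF kn(2)] by blast
    ultimately show ?thesis
      using regn(2) regn(4)
    proof eventually_elim
      case (elim t)
      show ?case
      proof
        assume t: "t \<in> interval T n"
        then have tI: "t \<in> {T n..T (n + 1)}" unfolding interval_def by auto
        define v where "v = w n t"
        have vV: "v \<in> V P 1" "v \<in> V P p" using elim t unfolding v_def w_def by auto
        define D where "D = \<epsilon> * pow_dual P 1 (u (n + 1) t) v - F (u (n + 1) t) v"
        have ED: "((\<lambda>t. energy P \<epsilon> \<F> (u (n + 1) t)) has_real_derivative D) (at t)"
          using elim t unfolding D_def v_def w_def by blast
        have kk: "{0..k - 1} = {..<k}" using k by auto
        \<comment> \<open>The scheme is tested with the time derivative itself.\<close>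
        have "inner v v + \<epsilon> * pow_dual P 1 (u (n + 1) t) v + A * \<kappa> * pow_dual P p v v
            = (\<Sum>i<k. lagrange_basis k T n i (t - T n) * F (node i) v)"
          using elim(1) t vV unfolding v_def w_def \<kappa>_def \<tau>_def node_def kk by blast
        moreover have "pow_dual P p v v = (V_norm P p v)\<^sup>2"
          unfolding pow_dual_def V_norm_def by (simp add: power2_norm_eq_inner)
        ultimately have "D = (\<Sum>i<k. lagrange_basis k T n i (t - T n) * F (node i) v) - F (u (n + 1) t) v
            - ((norm v)\<^sup>2 + A * \<kappa> * (V_norm P p v)\<^sup>2)"
          unfolding D_def by (simp add: power2_norm_eq_inner)
        also have "(\<Sum>i<k. lagrange_basis k T n i (t - T n) * F (node i) v) - F (u (n + 1) t) v
            = (\<Sum>j<k. (1 - S j t) * (F (node j) v - (if j = 0 then F (u (n + 1) t) v else F (node (j - 1)) v)))"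
          unfolding S_def by (rule sum_by_parts_partition[OF sum_lagrange_basis_eq_1[OF T k kn(1)]])
        also have "\<dots> = (\<Sum>j<k. (1 - S j t) * (F (node j) v - F (prev t j) v))"
          unfolding prev_def by (rule sum.cong) auto
        also have "\<dots> \<le> (\<Sum>j<k. (C\<^sub>L * G (n - j) / sqrt \<tau>) * (\<bar>1 - S j t\<bar> * hb t))"
        proof (rule sum_mono)
          fix j assume "j \<in> {..<k}"
          then have d: "prev t j \<in> V P \<gamma>" "node j \<in> V P \<gamma>" "cg * V_norm P \<gamma> (prev t j - node j) \<le> sqrt \<tau> * G (n - j)"
            using diff[of j, OF _ tI] by auto
          have vb: "v \<in> V P \<beta>" "cb * V_norm P \<beta> v \<le> hb t"
            using V_norm_young_stab(2)[OF P p(1,2) assms(20) \<kappa> vV(2)]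
              V_norm_le_young_envelope[OF P p(1,2) assms(20) \<kappa> vV(2)] unfolding cb_def hb_def v_def by auto
          have "(cg * V_norm P \<gamma> (prev t j - node j)) * (cb * V_norm P \<beta> v) \<le> (sqrt \<tau> * G (n - j)) * hb t"
            using cpos \<tau> by (intro mult_mono[OF d(3) vb(2)]) (simp_all add: V_norm_def G_def L2_norm_on_nonneg)
          then have "\<tau> * (V_norm P \<gamma> (prev t j - node j) * V_norm P \<beta> v) \<le> sqrt \<tau> * (G (n - j) * hb t)"
            unfolding cgcb[symmetric] by (simp add: mult_ac)
          then have "sqrt \<tau> * (sqrt \<tau> * (V_norm P \<gamma> (prev t j - node j) * V_norm P \<beta> v)) \<le> sqrt \<tau> * (G (n - j) * hb t)"
            using \<tau> by (simp add: mult.assoc[symmetric])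
          then have "V_norm P \<gamma> (prev t j - node j) * V_norm P \<beta> v \<le> G (n - j) * hb t / sqrt \<tau>"
            using \<tau> by (simp add: pos_le_divide_eq mult.commute)
          then have *: "C\<^sub>L * (V_norm P \<gamma> (prev t j - node j) * V_norm P \<beta> v) \<le> C\<^sub>L * (G (n - j) * hb t / sqrt \<tau>)"
            using assms(10) by (intro mult_left_mono) auto
          have "(1 - S j t) * (F (node j) v - F (prev t j) v) \<le> \<bar>1 - S j t\<bar> * \<bar>F (prev t j) v - F (node j) v\<bar>"
            by (metis abs_ge_self abs_minus_commute abs_mult)
          also have "\<dots> \<le> \<bar>1 - S j t\<bar> * (C\<^sub>L * (G (n - j) * hb t / sqrt \<tau>))"
            using lipschitz_rhs_le[OF P assms(12) d(1,2) vb(1)] * by (intro mult_left_mono) (auto simp: mult.assoc)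
          finally show "(1 - S j t) * (F (node j) v - F (prev t j) v)
              \<le> (C\<^sub>L * G (n - j) / sqrt \<tau>) * (\<bar>1 - S j t\<bar> * hb t)" by (simp add: mult_ac)
        qed
        finally have "D \<le> \<psi> t" unfolding \<psi>_def v_def by simp
        with ED show "\<exists>D\<le>\<psi> t. ((\<lambda>t. energy P \<epsilon> \<F> (u (n + 1) t)) has_real_derivative D) (at t)" by blast
      qed
    qed
  qed

  let ?I = "interval T n"
  note CS = L2_on_Cauchy_Schwarz[OF S_meas hb(2) S_L2 hb(1)]
  have int1: "set_integrable lebesgue ?I (\<lambda>t. \<Sum>j<k. (C\<^sub>L * G (n - j) / sqrt \<tau>) * (\<bar>1 - S j t\<bar> * hb t))"
    by (intro absolutely_integrable_sum set_integrable_mult_right CS(1)) simp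
  have int1_eq: "(LINT t:?I|lebesgue. (\<Sum>j<k. (C\<^sub>L * G (n - j) / sqrt \<tau>) * (\<bar>1 - S j t\<bar> * hb t)))
      = (\<Sum>j<k. (C\<^sub>L * G (n - j) / sqrt \<tau>) * (LINT t:?I|lebesgue. \<bar>1 - S j t\<bar> * hb t))"
    by (simp only: set_integral_sum[OF set_integrable_mult_right[OF CS(1)]] set_integral_mult_right)
  have int2: "set_integrable lebesgue ?I (\<lambda>t. (norm (w n t))\<^sup>2)" "set_integrable lebesgue ?I (\<lambda>t. (V_norm P p (w n t))\<^sup>2)"
    using regm[OF kn(2)] unfolding L2_on_def w_def by auto
  have int2': "set_integrable lebesgue ?I (\<lambda>t. (norm (w n t))\<^sup>2 + A * \<kappa> * (V_norm P p (w n t))\<^sup>2)"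
    using int2 by (intro set_integral_add(1) set_integrable_mult_right) auto
  have int2_eq: "(LINT t:?I|lebesgue. (norm (w n t))\<^sup>2 + A * \<kappa> * (V_norm P p (w n t))\<^sup>2) = X n + A * \<kappa> * Y n"
    unfolding X_def Y_def L2_norm_on_square using int2
    by (subst set_integral_add(2)) (auto intro!: set_integrable_mult_right)
  have "energy P \<epsilon> \<F> (u (n + 1) (T (n + 1))) - energy P \<epsilon> \<F> (u (n + 1) (T n)) \<le> (LINT t:?I|lebesgue. \<psi> t)"
  proof -
    have "set_integrable lebesgue ?I \<psi>"
      unfolding \<psi>_def[abs_def] by (rule set_integral_diff(1)[OF int1 int2'])
    then show ?thesis
      using increment_le_set_integral[of "T n" "T (n + 1)" "\<lambda>t. energy P \<epsilon> \<F> (u (n + 1) t)" \<psi>]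
        regn(3) deriv step_pos[of n] unfolding interval_def by simp
  qed
  also have "\<dots> = (\<Sum>j<k. (C\<^sub>L * G (n - j) / sqrt \<tau>) * (LINT t:?I|lebesgue. \<bar>1 - S j t\<bar> * hb t)) - (X n + A * \<kappa> * Y n)"
    unfolding \<psi>_def[abs_def] int1_eq[symmetric] int2_eq[symmetric] by (rule set_integral_diff(2)[OF int1 int2'])
  also have "(\<Sum>j<k. (C\<^sub>L * G (n - j) / sqrt \<tau>) * (LINT t:?I|lebesgue. \<bar>1 - S j t\<bar> * hb t))
      \<le> (\<Sum>j<k. C\<^sub>L * (Cs j * ((G (n - j))\<^sup>2 / 2 + B\<^sup>2 / 2)))"
  proof (rule sum_mono)
    fix j assume "j \<in> {..<k}"
    then have j: "j < k" by simp
    have Cs0: "0 \<le> Cs j"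
    proof (cases "j = 0")
      case False
      then have "1 \<le> j" "j \<le> k - 1" using j by auto
      from assms(18)[OF this] show ?thesis by simp
    qed (use assms(17) in simp)
    have G0: "0 \<le> G (n - j)" and B0: "0 \<le> B" unfolding G_def B_def by (rule L2_norm_on_nonneg)+
    have "(LINT t:?I|lebesgue. \<bar>1 - S j t\<bar> * hb t) \<le> Cs j * sqrt \<tau> * B"
      using CS(2)[of j] mult_right_mono[OF S_norm[OF j] B0] unfolding B_def by linarith
    then have "(C\<^sub>L * G (n - j) / sqrt \<tau>) * (LINT t:?I|lebesgue. \<bar>1 - S j t\<bar> * hb t)
        \<le> (C\<^sub>L * G (n - j) / sqrt \<tau>) * (Cs j * sqrt \<tau> * B)"
      using assms(10) G0 \<tau> by (intro mult_left_mono) auto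
    also have "\<dots> = C\<^sub>L * (Cs j * (G (n - j) * B))" using \<tau> by simp
    also have "\<dots> \<le> C\<^sub>L * (Cs j * ((G (n - j))\<^sup>2 / 2 + B\<^sup>2 / 2))"
      using zero_le_power2[of "G (n - j) - B"] assms(10) Cs0
      by (intro mult_left_mono) (auto simp: power2_diff)
    finally show "(C\<^sub>L * G (n - j) / sqrt \<tau>) * (LINT t:?I|lebesgue. \<bar>1 - S j t\<bar> * hb t)
        \<le> C\<^sub>L * (Cs j * ((G (n - j))\<^sup>2 / 2 + B\<^sup>2 / 2))" .
  qed
  also have "\<dots> = C\<^sub>L * (C\<^sub>3 * (\<Sum>j<k. Cs j * X (n - j)) + C\<^sub>4 * \<kappa> * (\<Sum>j<k. Cs j * Y (n - j))
      + C_bar k Cs 0 * (B\<^sup>2 / 2))"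
  proof -
    have kk: "{0..k - 1} = {..<k}" using k by auto
    have "(\<Sum>j<k. Cs j * ((G (n - j))\<^sup>2 / 2 + B\<^sup>2 / 2))
        = (\<Sum>j<k. C\<^sub>3 * (Cs j * X (n - j)) + C\<^sub>4 * \<kappa> * (Cs j * Y (n - j)) + Cs j * (B\<^sup>2 / 2))"
    proof (rule sum.cong[OF refl])
      fix j assume "j \<in> {..<k}"
      then have "1 \<le> n - j" using n by auto
      from Gsq[OF this] show "Cs j * ((G (n - j))\<^sup>2 / 2 + B\<^sup>2 / 2)
          = C\<^sub>3 * (Cs j * X (n - j)) + C\<^sub>4 * \<kappa> * (Cs j * Y (n - j)) + Cs j * (B\<^sup>2 / 2)"
        by (simp add: algebra_simps)
    qed
    then show ?thesis
      unfolding C_bar_def kk by (simp add: sum_distrib_left[symmetric] sum.distrib sum_distrib_right)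
  qed
  finally have E: "energy P \<epsilon> \<F> (u (n + 1) (T (n + 1))) - energy P \<epsilon> \<F> (u n (T n))
      \<le> C\<^sub>L * (C\<^sub>3 * (\<Sum>j<k. Cs j * X (n - j)) + C\<^sub>4 * \<kappa> * (\<Sum>j<k. Cs j * Y (n - j))
      + C_bar k Cs 0 * (B\<^sup>2 / 2)) - (X n + A * \<kappa> * Y n)"
    by (simp add: start[simplified])

  \<comment> \<open>It remains to shift the memory terms from \<open>n\<close> to \<open>n + 1\<close>. The stabilization coefficient \<open>A\<close> cancels the terms with \<open>Y n\<close> exactly, and the condition on the constants makes the factor of \<open>X n\<close> nonpositive.\<close>
  have modE: "modified_energy P \<epsilon> \<F> C\<^sub>L C\<^sub>3 C\<^sub>4 p Cs k T u m = energy P \<epsilon> \<F> (u m (T m))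
      + C\<^sub>L * (C\<^sub>3 * (\<Sum>j=1..k - 1. C_bar k Cs j * X (m - j)) + C\<^sub>4 * \<kappa> * (\<Sum>j=1..k - 1. C_bar k Cs j * Y (m - j)))" for m
    unfolding modified_energy_def X_def Y_def w_def \<kappa>_def \<tau>_def
    by (simp add: sum_distrib_left distrib_left mult_ac)
  define Cb where "Cb = C_bar k Cs 0"
  have "Cs 0 \<le> Cb" unfolding Cb_def C_bar_def
  proof (rule member_le_sum)
    fix l assume "l \<in> {0..k - 1} - {0}"
    then have "1 \<le> l" "l \<le> k - 1" by auto
    from assms(18)[OF this] show "0 \<le> Cs l" by simp
  qed auto
  then have Cb: "Cb > 0" using assms(17) by simp
  define y where "y = young_coeff p \<beta> Chat"
  define s where "s = stab_coeff p \<beta> Chat"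
  define R where "R = (\<Sum>j=1..k - 1. C_bar k Cs j * X (n - j))"
  define Q where "Q = (\<Sum>j=1..k - 1. C_bar k Cs j * Y (n - j))"
  have "modified_energy P \<epsilon> \<F> C\<^sub>L C\<^sub>3 C\<^sub>4 p Cs k T u (n + 1) - energy P \<epsilon> \<F> (u n (T n))
      \<le> C\<^sub>L * (C\<^sub>3 * ((\<Sum>j<k. Cs j * X (n - j)) + (\<Sum>j=1..k - 1. C_bar k Cs j * X (n + 1 - j)))
        + C\<^sub>4 * \<kappa> * ((\<Sum>j<k. Cs j * Y (n - j)) + (\<Sum>j=1..k - 1. C_bar k Cs j * Y (n + 1 - j)))
        + Cb * (B\<^sup>2 / 2)) - (X n + A * \<kappa> * Y n)"
    using E unfolding modE Cb_def by (simp add: algebra_simps)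
  also have "\<dots> = C\<^sub>L * (C\<^sub>3 * (Cb * X n + R) + C\<^sub>4 * \<kappa> * (Cb * Y n + Q) + Cb * (B\<^sup>2 / 2)) - (X n + A * \<kappa> * Y n)"
    unfolding sum_C_bar_telescope[OF k] Cb_def R_def Q_def ..
  also have "\<dots> = C\<^sub>L * (C\<^sub>3 * R + C\<^sub>4 * \<kappa> * Q) + (C\<^sub>L * Cb * (C\<^sub>3 + y / 2) - 1) * X n"
    unfolding Bsq assms(23) y_def[symmetric] s_def[symmetric] assms(25)[symmetric] Cb_def[symmetric]
    by (simp add: field_simps)
  also have "\<dots> \<le> C\<^sub>L * (C\<^sub>3 * R + C\<^sub>4 * \<kappa> * Q)"
  proof -
    have "y + 2 * C\<^sub>3 \<le> 2 / (C\<^sub>L * Cb)" using assms(22,24) unfolding y_def Cb_def by simp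
    then have "C\<^sub>L * Cb * (C\<^sub>3 + y / 2) \<le> 1" using assms(10) Cb by (simp add: field_simps)
    moreover have "0 \<le> X n" unfolding X_def by simp
    ultimately show ?thesis using mult_nonpos_nonneg[of "C\<^sub>L * Cb * (C\<^sub>3 + y / 2) - 1" "X n"] by simp
  qed
  finally show "modified_energy P \<epsilon> \<F> C\<^sub>L C\<^sub>3 C\<^sub>4 p Cs k T u (n + 1)
                  \<le> modified_energy P \<epsilon> \<F> C\<^sub>L C\<^sub>3 C\<^sub>4 p Cs k T u n"
    unfolding modE[of n] R_def Q_def by simp
qed

end
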